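(* Let $T_1$ and $T_2$ be finitely generated, commutative, reduced and cancellative semigroups with zero, minimally generated by $A_1=\{a_1,\dots,a_r\}$ and $A_2=\{b_1,\dots,b_t\}$ respectively, such that $I_{T_1}$ and $I_{T_2}$ are nontrivial proper ideals of their polynomial rings. Let $L_1$ and $L_2$ be integer matrices whose rows form a basis of $\ker T_1\subset\mathbb{Z}^r$ and $\ker T_2\subset\mathbb{Z}^t$ respectively, let $\gamma_X\in\mathbb{N}^r$ and $\gamma_Y\in\mathbb{N}^t$ be nonzero, and let $$A=\left(\begin{array}{c|c} L_1&0\\ \hline 0&L_2\\ \hline \gamma_X&-\gamma_Y\end{array}\right).$$ Let $S=\langle B_1,B_2\rangle$ be a finitely generated, commutative, reduced and cancellative semigroup with zero, where $B_1$ and $B_2$ have cardinality $r$ and $t$ respectively, such that $\ker(\langle B_1,B_2\rangle)\subset\mathbb{Z}^{r+t}$ is the lattice generated by the rows of $A$. For $j=1,2$ let $P_j,Q_j$ be unimodular integer matrices such that $D_j=P_jL_jQ_j$ is the Smith Normal Form of $L_j$, with its zero-columns located on the right side; let $s_j$ be the number of zero-columns of $D_j$; and put $\gamma'_X=\gamma_XQ_1$ and $\gamma'_Y=-\gamma_YQ_2$. Then $S$ is an affine glued semigroup if and only if: 1. $T_1$ and $T_2$ are two affine semigroups. 2. $(\gamma_X,\gamma_Y)\in\mathbb{N}^{r+t}$. 3. $\sum_{i=1}^r\gamma_{Xi}>1$ and $\sum_{i=1}^t\gamma_{Yi}>1$. 4. There exist $f_{r-s_1+1},\dots,f_r,g_{t-s_2+1},\dots,g_t\in\mathbb{Z}$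 such that $$(f_{r-s_1+1},\dots,f_r)\cdot(\gamma'_{X(r-s_1+1)},\dots,\gamma'_{Xr})+(g_{t-s_2+1},\dots,g_t)\cdot(\gamma'_{Y(t-s_2+1)},\dots,\gamma'_{Yt})=1.$$
   Context: A semigroup $T$ is cancellative if $m+n=m+n'$ implies $n=n'$, and reduced if $T\cap(-T)=\{0\}$. A finitely generated commutative reduced cancellative semigroup is affine if it is torsion-free, equivalently if it is isomorphic to a subsemigroup of some $\mathbb{N}^p$. "Minimally generated" means that no generator belongs to the semigroup generated by the others. For a semigroup $T$ with an ordered generating family $(n_1,\dots,n_l)$, $\ker T=\{\alpha\in\mathbb{Z}^l\mid\sum_{i=1}^l\alpha_i n_i=0\}$. For a field $\Bbbk$, the semigroup ideal $I_T\subset\Bbbk[X_1,\dots,X_l]$ is the ideal generated by all $X^\alpha-X^\beta$ with $\sum\alpha_in_i=\sum\beta_in_i$. For $\langle B_1,B_2\rangle$, the generators are ordered with those of $B_1$ first and then those of $B_2$. Definition (gluing, glued semigroup). Let $S$ be a finitely generated, commutative, reduced, cancellative semigroup with zero, minimally generated by $E_1\sqcup E_2$, and take the polynomial ring with indeterminates $X$ corresponding to the elements of $E_1$ and indeterminates $Y$ corresponding to the elements of $E_2$. $S$ is the gluing of $S_1=\langle E_1\rangle$ and $S_2=\langle E_2\rangle$ if there is a binomial $X^{\gamma}-Y^{\gamma'}\in I_S$ such that $I_S=I_{S_1}+I_{S_2}+\langle X^{\gamma}-Y^{\gamma'}\rangle$. A semigroup is a glued semigroup when it is the gluing of two other semigroups.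 An affine glued semigroup is a glued semigroup that is affine. A unimodular matrix is a square integer matrix with determinant $\pm1$.
   Formalization: "Glued semigroup" is taken to mean that S is the gluing of ⟨B_1⟩ and ⟨B_2⟩, minimally generated by B_1⊔B_2; with gluing along any pair the claim fails: T_1=T_2=⟨2,3⟩, γ_X=(1,0), γ_Y=(1,1), S=⟨10,15,4,6⟩=⟨4,6,15⟩ is affine and glued but condition 3 fails. *)

theory Defs
  imports
    "Jordan_Normal_Form.Determinant"
    "HOL-Library.Poly_Mapping"
    "HOL-Algebra.Ideal"
begin

(* Semigroups with zero are submonoids of an arbitrary commutative monoid type. That type is
   not assumed to be cancellative; this is required of the submonoid only. *)

inductive_set sgp_gen :: "'a::comm_monoid_add set \<Rightarrow> 'a set" (\<open>\<langle>_\<rangle>\<close>)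
  for E :: "'a::comm_monoid_add set" where
  zero: "0 \<in> \<langle>E\<rangle>"
| add: "e \<in> E \<Longrightarrow> x \<in> \<langle>E\<rangle> \<Longrightarrow> e + x \<in> \<langle>E\<rangle>"

definition nmult :: "nat \<Rightarrow> 'a::comm_monoid_add \<Rightarrow> 'a" where
  "nmult k x = (\<Sum>i<k. x)"

definition finitely_generated :: "'a::comm_monoid_add set \<Rightarrow> bool" where
  "finitely_generated T \<longleftrightarrow> (\<exists>E. finite E \<and> T = \<langle>E\<rangle>)"

definition cancellative :: "'a::comm_monoid_add set \<Rightarrow> bool" where
  "cancellative T \<longleftrightarrow> (\<forall>m\<in>T. \<forall>n\<in>T. \<forall>n'\<in>T. m + n = m + n' \<longrightarrow> n = n')"

(* T \<inter> (-T) is the set of elements of T whose negative exists and lies in T. *)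
definition reduced :: "'a::comm_monoid_add set \<Rightarrow> bool" where
  "reduced T \<longleftrightarrow> {x \<in> T. \<exists>y\<in>T. x + y = 0} = {0}"

definition torsion_free :: "'a::comm_monoid_add set \<Rightarrow> bool" where
  "torsion_free T \<longleftrightarrow> (\<forall>k>0. \<forall>x\<in>T. \<forall>y\<in>T. nmult k x = nmult k y \<longrightarrow> x = y)"

definition fg_red_canc :: "'a::comm_monoid_add set \<Rightarrow> bool" where
  "fg_red_canc T \<longleftrightarrow> finitely_generated T \<and> reduced T \<and> cancellative T"

definition affine_sgp :: "'a::comm_monoid_add set \<Rightarrow> bool" where
  "affine_sgp T \<longleftrightarrow> fg_red_canc T \<and> torsion_free T"

definition minimally_generates :: "'a::comm_monoid_add set \<Rightarrow> 'a set \<Rightarrow> bool" where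
  "minimally_generates E T \<longleftrightarrow> T = \<langle>E\<rangle> \<and> (\<forall>e\<in>E. e \<notin> \<langle>E - {e}\<rangle>)"

(* The sum of the a_i n_i is formed in the group of differences of the semigroup; it vanishes
   there iff the part with positive and the part with negative coefficients agree in the
   (cancellative) semigroup. *)
definition ker_sgp :: "'a::comm_monoid_add list \<Rightarrow> int vec set" where
  "ker_sgp ns = {a \<in> carrier_vec (length ns).
     (\<Sum>i<length ns. nmult (nat (a $ i)) (ns ! i)) =
     (\<Sum>i<length ns. nmult (nat (- (a $ i))) (ns ! i))}"

(* The generators themselves serve as the names of the indeterminates: a monomial is a finitely
   supported exponent function, a polynomial a finitely supported coefficient function on
   monomials, and poly_ring E is the ring of polynomials in the indeterminates in E. *)

type_synonym ('a, 'k) mpoly = "('a \<Rightarrow>\<^sub>0 nat) \<Rightarrow>\<^sub>0 'k"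

definition poly_ring :: "'a set \<Rightarrow> ('a, 'k::field) mpoly ring" where
  "poly_ring E = \<lparr>carrier = {p. \<forall>m\<in>Poly_Mapping.keys p. Poly_Mapping.keys m \<subseteq> E},
     monoid.mult = (*), one = 1, zero = 0, add = (+)\<rparr>"

definition xpow :: "('a \<Rightarrow>\<^sub>0 nat) \<Rightarrow> ('a, 'k::field) mpoly" where
  "xpow \<alpha> = Poly_Mapping.single \<alpha> 1"

definition sgp_value :: "('a::comm_monoid_add \<Rightarrow>\<^sub>0 nat) \<Rightarrow> 'a" where
  "sgp_value \<alpha> = (\<Sum>e\<in>Poly_Mapping.keys \<alpha>. nmult (Poly_Mapping.lookup \<alpha> e) e)"

definition sgp_ideal :: "'a::comm_monoid_add set \<Rightarrow> ('a, 'k::field) mpoly set" where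
  "sgp_ideal E = Idl\<^bsub>poly_ring E\<^esub> {xpow \<alpha> - xpow \<beta> | \<alpha> \<beta>.
     Poly_Mapping.keys \<alpha> \<subseteq> E \<and> Poly_Mapping.keys \<beta> \<subseteq> E \<and> sgp_value \<alpha> = sgp_value \<beta>}"

(* The ideals of the two smaller polynomial rings are extended to the polynomial ring in all
   indeterminates before they are added. The type argument names the coefficient field. *)
definition is_gluing ::
    "'k::field itself \<Rightarrow> 'a::comm_monoid_add set \<Rightarrow> 'a set \<Rightarrow> 'a set \<Rightarrow> bool" where
  "is_gluing _ S E1 E2 \<longleftrightarrow>
     fg_red_canc S \<and> E1 \<inter> E2 = {} \<and> minimally_generates (E1 \<union> E2) S \<and>
     (let R = poly_ring (E1 \<union> E2) :: ('a, 'k) mpoly ring in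
       \<exists>\<gamma> \<gamma>'. Poly_Mapping.keys \<gamma> \<subseteq> E1 \<and> Poly_Mapping.keys \<gamma>' \<subseteq> E2 \<and>
         xpow \<gamma> - xpow \<gamma>' \<in> (sgp_ideal (E1 \<union> E2) :: ('a, 'k) mpoly set) \<and>
         sgp_ideal (E1 \<union> E2) =
           Idl\<^bsub>R\<^esub> (sgp_ideal E1) <+>\<^bsub>R\<^esub> Idl\<^bsub>R\<^esub> (sgp_ideal E2) <+>\<^bsub>R\<^esub> Idl\<^bsub>R\<^esub> {xpow \<gamma> - xpow \<gamma>'})"

definition vec_mat :: "int vec \<Rightarrow> int mat \<Rightarrow> int vec" where
  "vec_mat v M = transpose_mat M *\<^sub>v v"

definition row_lattice :: "int mat \<Rightarrow> int vec set" where
  "row_lattice M = {vec_mat c M | c. c \<in> carrier_vec (dim_row M)}"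

definition rows_form_basis :: "int mat \<Rightarrow> int vec set \<Rightarrow> bool" where
  "rows_form_basis M K \<longleftrightarrow> row_lattice M = K \<and>
     (\<forall>c \<in> carrier_vec (dim_row M). vec_mat c M = 0\<^sub>v (dim_col M) \<longrightarrow> c = 0\<^sub>v (dim_row M))"

definition glue_mat :: "int mat \<Rightarrow> int mat \<Rightarrow> int vec \<Rightarrow> int vec \<Rightarrow> int mat" where
  "glue_mat L1 L2 gX gY =
     four_block_mat L1 (0\<^sub>m (dim_row L1) (dim_col L2)) (0\<^sub>m (dim_row L2) (dim_col L1)) L2
       @\<^sub>r mat_of_row (gX @\<^sub>v - gY)"

definition unimodular :: "nat \<Rightarrow> int mat \<Rightarrow> bool" where
  "unimodular n M \<longleftrightarrow> M \<in> carrier_mat n n \<and> (det M = 1 \<or> det M = - 1)"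

(* Since 0 divides only 0, the divisibility chain puts the zero diagonal entries last. *)
definition smith_normal_form :: "int mat \<Rightarrow> bool" where
  "smith_normal_form D \<longleftrightarrow>
     (\<forall>i<dim_row D. \<forall>j<dim_col D. i \<noteq> j \<longrightarrow> D $$ (i, j) = 0) \<and>
     (\<forall>i<min (dim_row D) (dim_col D). 0 \<le> D $$ (i, i)) \<and>
     (\<forall>i. Suc i < min (dim_row D) (dim_col D) \<longrightarrow> D $$ (i, i) dvd D $$ (Suc i, Suc i))"

definition num_zero_cols :: "int mat \<Rightarrow> nat" where
  "num_zero_cols D = card {j. j < dim_col D \<and> col D j = 0\<^sub>v (dim_row D)}"

definition zero_cols_right :: "int mat \<Rightarrow> bool" where
  "zero_cols_right D \<longleftrightarrow> (\<forall>j<dim_col D.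
     col D j = 0\<^sub>v (dim_row D) \<longleftrightarrow> dim_col D - num_zero_cols D \<le> j)"

lemma cring_poly_ring: "cring (poly_ring E :: ('a, 'k::field) mpoly ring)"
proof -
  have k0: "(0 :: ('a, 'k) mpoly) \<in> carrier (poly_ring E)"
    by (simp add: poly_ring_def)
  have k1: "(1 :: ('a, 'k) mpoly) \<in> carrier (poly_ring E)"
    by (auto simp: poly_ring_def simp flip: single_one)
  have ka: "p + q \<in> carrier (poly_ring E)"
    if "p \<in> carrier (poly_ring E)" "q \<in> carrier (poly_ring E)" for p q :: "('a, 'k) mpoly"
    using that Poly_Mapping.keys_add[of p q] unfolding poly_ring_def by simp blast
  have km: "p * q \<in> carrier (poly_ring E)"
    if pq: "p \<in> carrier (poly_ring E)" "q \<in> carrier (poly_ring E)" for p q :: "('a, 'k) mpoly"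
  proof -
    have "Poly_Mapping.keys m \<subseteq> E" if m: "m \<in> Poly_Mapping.keys (p * q)" for m
    proof -
      obtain a b where ab: "m = a + b" "a \<in> Poly_Mapping.keys p" "b \<in> Poly_Mapping.keys q"
        using m keys_mult[of p q] by blast
      have "Poly_Mapping.keys a \<subseteq> E" "Poly_Mapping.keys b \<subseteq> E"
        using ab pq by (simp_all add: poly_ring_def)
      then show ?thesis using Poly_Mapping.keys_add[of a b] ab(1) by blast
    qed
    then show ?thesis by (simp add: poly_ring_def)
  qed
  have kn: "- p \<in> carrier (poly_ring E)"
    if "p \<in> carrier (poly_ring E)" for p :: "('a, 'k) mpoly"
    using that by (simp add: poly_ring_def)
  have sel: "\<zero>\<^bsub>poly_ring E\<^esub> = (0 :: ('a, 'k) mpoly)" "\<one>\<^bsub>poly_ring E\<^esub> = (1 :: ('a, 'k) mpoly)"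
    "p \<oplus>\<^bsub>poly_ring E\<^esub> q = p + q" "p \<otimes>\<^bsub>poly_ring E\<^esub> q = p * q" for p q :: "('a, 'k) mpoly"
    by (simp_all add: poly_ring_def)
  have grp: "abelian_group (poly_ring E :: ('a, 'k) mpoly ring)"
    by (rule abelian_groupI; unfold sel)
      (simp_all add: k0 ka add.assoc add.commute, metis kn add.left_inverse add.commute)
  have mon: "Group.comm_monoid (poly_ring E :: ('a, 'k) mpoly ring)"
    by (rule Group.comm_monoidI; unfold sel) (simp_all add: k1 km mult.assoc mult.commute)
  show ?thesis
    by (rule cringI[OF grp mon]; unfold sel) (rule distrib_right)
qed

lemma mem_ker_sgp_iff:
  fixes ns :: "'a::ab_group_add list" and a :: "int vec"
  assumes "a \<in> carrier_vec (length ns)"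
  shows "a \<in> ker_sgp ns \<longleftrightarrow>
    (\<Sum>i<length ns. if 0 \<le> a $ i then nmult (nat (a $ i)) (ns ! i)
                     else - nmult (nat (- (a $ i))) (ns ! i)) = 0"
proof -
  have "(\<Sum>i<length ns. if 0 \<le> a $ i then nmult (nat (a $ i)) (ns ! i)
                     else - nmult (nat (- (a $ i))) (ns ! i)) =
    (\<Sum>i<length ns. nmult (nat (a $ i)) (ns ! i) - nmult (nat (- (a $ i))) (ns ! i))"
    by (rule sum.cong) (auto simp: nmult_def)
  then show ?thesis using assms by (simp add: ker_sgp_def sum_subtractf)
qed

end

theory Submission
  imports Defs
begin

text \<open>The lattice generated by the rows of the glued matrix consists of the vectors
  \<open>(u + c \<gamma>\<^sub>X, v - c \<gamma>\<^sub>Y)\<close> with \<open>u \<in> ker T\<^sub>1\<close>, \<open>v \<in> ker T\<^sub>2\<close> and \<open>c \<in> \<int>\<close>. So two elements of \<open>S\<close>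
  agree iff their components agree in \<open>T\<^sub>1\<close> and \<open>T\<^sub>2\<close> after moving \<open>c\<close> copies of \<open>\<gamma>\<^sub>X\<close> to one side
  and \<open>c\<close> copies of \<open>\<gamma>\<^sub>Y\<close> to the other, and the gluing of ideals is the telescoping of this move.
  As \<open>T\<^sub>1\<close> and \<open>T\<^sub>2\<close> are reduced, a generator of \<open>S\<close> is redundant only if \<open>\<gamma>\<^sub>X\<close> or \<open>\<gamma>\<^sub>Y\<close> is a
  unit vector. Finally \<open>S\<close> is torsion-free iff \<open>T\<^sub>1\<close> and \<open>T\<^sub>2\<close> are and \<open>(\<gamma>\<^sub>X, - \<gamma>\<^sub>Y)\<close> is
  primitive modulo \<open>ker T\<^sub>1 \<times> ker T\<^sub>2\<close>; in Smith coordinates this is the Bezout condition on the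
  last coordinates.\<close>

section \<open>Semigroup elements as combinations of generators\<close>

lemma nmult_0 [simp]: "nmult 0 x = 0"
  and nmult_Suc: "nmult (Suc k) x = x + nmult k x"
  by (simp_all add: nmult_def add.commute)

lemma nmult_1 [simp]: "nmult (Suc 0) x = x"
  by (simp add: nmult_def)

lemma nmult_add: "nmult (j + k) x = nmult j x + nmult k x"
  by (induction j) (simp_all add: nmult_Suc add.assoc)

lemma nmult_mult: "nmult (j * k) x = nmult j (nmult k x)"
  by (induction j) (simp_all add: nmult_Suc nmult_add)

lemma nmult_sum: "nmult k (sum f A) = (\<Sum>i\<in>A. nmult k (f i))"
  unfolding nmult_def by (rule sum.swap)

text \<open>Coefficients are total functions on indices, so they can be added, scaled and shifted
  without length conditions; values beyond the list never matter (\<open>comb_cong\<close>).\<close>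

definition comb :: "'a::comm_monoid_add list \<Rightarrow> (nat \<Rightarrow> nat) \<Rightarrow> 'a" where
  "comb ns \<alpha> = (\<Sum>i<length ns. nmult (\<alpha> i) (ns ! i))"

lemma comb_cong: "(\<And>i. i < length ns \<Longrightarrow> \<alpha> i = \<beta> i) \<Longrightarrow> comb ns \<alpha> = comb ns \<beta>"
  by (simp add: comb_def)

lemma comb_zero [simp]: "comb ns (\<lambda>i. 0) = 0"
  by (simp add: comb_def)

lemma comb_add: "comb ns (\<lambda>i. \<alpha> i + \<beta> i) = comb ns \<alpha> + comb ns \<beta>"
  by (simp add: comb_def nmult_add sum.distrib)

lemma comb_mult: "comb ns (\<lambda>i. k * \<alpha> i) = nmult k (comb ns \<alpha>)"
  by (simp add: comb_def nmult_mult nmult_sum)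

lemma comb_unit: "i < length ns \<Longrightarrow> comb ns (\<lambda>j. if j = i then 1 else 0) = ns ! i"
proof -
  assume i: "i < length ns"
  have "comb ns (\<lambda>j. if j = i then 1 else 0) = (\<Sum>j<length ns. if j = i then ns ! i else 0)"
    unfolding comb_def by (rule sum.cong) auto
  also have "\<dots> = ns ! i" using i by simp
  finally show ?thesis .
qed

lemma comb_append:
  "comb (ms @ ns) \<alpha> = comb ms \<alpha> + comb ns (\<lambda>i. \<alpha> (length ms + i))"
proof -
  have 1: "(\<Sum>i<length ms. nmult (\<alpha> i) ((ms @ ns) ! i)) = comb ms \<alpha>"
    unfolding comb_def by (rule sum.cong) (simp_all add: nth_append)
  have "x \<in> {..<length ms} \<union> (\<lambda>i. length ms + i) ` {..<length ns}" if "x < length ms + length ns" for x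
    using that image_eqI[of x "\<lambda>i. length ms + i" "x - length ms" "{..<length ns}"]
    by (cases "x < length ms") auto
  then have "{..<length ms + length ns} = {..<length ms} \<union> (\<lambda>i. length ms + i) ` {..<length ns}"
    by auto
  then have "comb (ms @ ns) \<alpha> =
      (\<Sum>i\<in>{..<length ms} \<union> (\<lambda>i. length ms + i) ` {..<length ns}. nmult (\<alpha> i) ((ms @ ns) ! i))"
    by (simp only: comb_def length_append)
  also have "\<dots> = (\<Sum>i<length ms. nmult (\<alpha> i) ((ms @ ns) ! i)) +
      (\<Sum>i\<in>(\<lambda>i. length ms + i) ` {..<length ns}. nmult (\<alpha> i) ((ms @ ns) ! i))"
    by (rule sum.union_disjoint) auto
  also have "(\<Sum>i\<in>(\<lambda>i. length ms + i) ` {..<length ns}. nmult (\<alpha> i) ((ms @ ns) ! i)) =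
      comb ns (\<lambda>i. \<alpha> (length ms + i))"
    by (simp add: sum.reindex comb_def)
  finally show ?thesis unfolding 1 .
qed

lemma comb_split_append:
  "comb (ms @ ns) (\<lambda>i. if i < length ms then \<alpha> i else \<beta> (i - length ms)) = comb ms \<alpha> + comb ns \<beta>"
proof -
  have "comb ms (\<lambda>i. if i < length ms then \<alpha> i else \<beta> (i - length ms)) = comb ms \<alpha>"
    by (rule comb_cong) simp
  then show ?thesis by (simp add: comb_append)
qed

text \<open>Restricting indices instead of elements covers both the whole list and the list with one
  generator left out; the second case is what minimality is about.\<close>

lemma sgp_gen_image_iff:
  assumes "J \<subseteq> {..<length ns}"
  shows "x \<in> \<langle>(!) ns ` J\<rangle> \<longleftrightarrow> (\<exists>\<alpha>. (\<forall>i. i \<notin> J \<longrightarrow> \<alpha> i = 0) \<and> comb ns \<alpha> = x)"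
proof
  assume "x \<in> \<langle>(!) ns ` J\<rangle>"
  then show "\<exists>\<alpha>. (\<forall>i. i \<notin> J \<longrightarrow> \<alpha> i = 0) \<and> comb ns \<alpha> = x"
  proof induction
    case zero
    show ?case by (rule exI[of _ "\<lambda>i. 0"]) simp
  next
    case (add e x)
    then obtain j \<alpha> where j: "j \<in> J" "e = ns ! j"
      and \<alpha>: "\<forall>i. i \<notin> J \<longrightarrow> \<alpha> i = 0" "comb ns \<alpha> = x" by auto
    have "comb ns (\<lambda>i. (if i = j then 1 else 0) + \<alpha> i) = e + x"
      unfolding comb_add using comb_unit[of j ns] j assms \<alpha> by auto
    then show ?case using \<alpha> j by (intro exI[of _ "\<lambda>i. (if i = j then 1 else 0) + \<alpha> i"]) auto
  qed
next
  assume "\<exists>\<alpha>. (\<forall>i. i \<notin> J \<longrightarrow> \<alpha> i = 0) \<and> comb ns \<alpha> = x"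
  then obtain \<alpha> where \<alpha>: "\<forall>i. i \<notin> J \<longrightarrow> \<alpha> i = 0" "comb ns \<alpha> = x" by blast
  have nm: "nmult k e + y \<in> \<langle>(!) ns ` J\<rangle>" if "y \<in> \<langle>(!) ns ` J\<rangle>" "e \<in> (!) ns ` J" for k e y
    using that by (induction k) (auto simp: nmult_Suc add.assoc intro: sgp_gen.add)
  \<comment> \<open>The bound \<open>m\<close> may exceed the length of the list: there
    \<open>m \<notin> J\<close>, so the coefficient is zero and the value of \<open>ns ! m\<close>
    is irrelevant.\<close>
  have "(\<Sum>i<m. nmult (\<alpha> i) (ns ! i)) \<in> \<langle>(!) ns ` J\<rangle>" for m
  proof (induction m)
    case 0
    show ?case by (simp add: sgp_gen.zero)
  next
    case (Suc m)
    have "nmult (\<alpha> m) (ns ! m) + (\<Sum>i<m. nmult (\<alpha> i) (ns ! i)) \<in> \<langle>(!) ns ` J\<rangle>"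
      using nm[OF Suc, of "ns ! m" "\<alpha> m"] \<alpha>(1) Suc by (cases "m \<in> J") auto
    then show ?case by (simp add: add.commute)
  qed
  from this[of "length ns"] show "x \<in> \<langle>(!) ns ` J\<rangle>"
    unfolding comb_def[symmetric] \<alpha>(2) .
qed

lemma sgp_gen_set_iff: "x \<in> \<langle>set ns\<rangle> \<longleftrightarrow> (\<exists>\<alpha>. comb ns \<alpha> = x)"
proof -
  have s: "set ns = (!) ns ` {..<length ns}" by (auto simp: set_conv_nth)
  have "x \<in> \<langle>set ns\<rangle> \<longleftrightarrow> (\<exists>\<alpha>. (\<forall>i. i \<notin> {..<length ns} \<longrightarrow> \<alpha> i = 0) \<and> comb ns \<alpha> = x)"
    unfolding s by (rule sgp_gen_image_iff) simp
  also have "\<dots> \<longleftrightarrow> (\<exists>\<alpha>. comb ns \<alpha> = x)"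
  proof safe
    fix \<alpha>
    have "comb ns (\<lambda>i. if i < length ns then \<alpha> i else 0) = comb ns \<alpha>" by (rule comb_cong) simp
    then show "\<exists>\<alpha>'. (\<forall>i. i \<notin> {..<length ns} \<longrightarrow> \<alpha>' i = 0) \<and> comb ns \<alpha>' = comb ns \<alpha>"
      by (intro exI[of _ "\<lambda>i. if i < length ns then \<alpha> i else 0"]) simp
  qed auto
  finally show ?thesis .
qed

lemma comb_in_sgp_gen: "comb ns \<alpha> \<in> \<langle>set ns\<rangle>"
  by (auto simp: sgp_gen_set_iff)

section \<open>Minimal generation in terms of coefficients\<close>

definition irredundant :: "'a::comm_monoid_add list \<Rightarrow> bool" where
  "irredundant ns \<longleftrightarrow> (\<forall>i<length ns. \<forall>\<alpha>. \<alpha> i = 0 \<longrightarrow> comb ns \<alpha> \<noteq> ns ! i)"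

text \<open>Irredundance leaves out an index, not an element. A repeated entry is thus a combination
  of its other copy, which is why distinctness comes for free.\<close>

lemma irredundant_iff:
  "irredundant ns \<longleftrightarrow> distinct ns \<and> minimally_generates (set ns) \<langle>set ns\<rangle>"
proof -
  have gen: "ns ! i \<notin> \<langle>set ns - {ns ! i}\<rangle> \<longleftrightarrow> (\<forall>\<alpha>. \<alpha> i = 0 \<longrightarrow> comb ns \<alpha> \<noteq> ns ! i)"
    if d: "distinct ns" and i: "i < length ns" for i
  proof -
    have "set ns - {ns ! i} = (!) ns ` ({..<length ns} - {i})"
      using d i by (auto simp: set_conv_nth nth_eq_iff_index_eq)
    then have "ns ! i \<in> \<langle>set ns - {ns ! i}\<rangle> \<longleftrightarrow>
        (\<exists>\<alpha>. (\<forall>j. j \<notin> {..<length ns} - {i} \<longrightarrow> \<alpha> j = 0) \<and> comb ns \<alpha> = ns ! i)"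
      using sgp_gen_image_iff[of "{..<length ns} - {i}" ns] by auto
    also have "\<dots> \<longleftrightarrow> (\<exists>\<alpha>. \<alpha> i = 0 \<and> comb ns \<alpha> = ns ! i)"
    proof safe
      fix \<alpha> :: "nat \<Rightarrow> nat" assume \<alpha>: "\<alpha> i = 0" "comb ns \<alpha> = ns ! i"
      let ?\<alpha> = "\<lambda>j. if j < length ns then \<alpha> j else 0"
      have "comb ns ?\<alpha> = comb ns \<alpha>" by (rule comb_cong) simp
      then show "\<exists>\<alpha>. (\<forall>j. j \<notin> {..<length ns} - {i} \<longrightarrow> \<alpha> j = 0) \<and> comb ns \<alpha> = ns ! i"
        using \<alpha> by (intro exI[of _ ?\<alpha>]) auto
    qed auto
    finally show ?thesis by blast
  qed
  have dist: "distinct ns" if "irredundant ns"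
  proof (rule ccontr)
    assume "\<not> distinct ns"
    then obtain i j where ij: "i < length ns" "j < length ns" "i \<noteq> j" "ns ! i = ns ! j"
      by (auto simp: distinct_conv_nth)
    then have "comb ns (\<lambda>k. if k = j then 1 else 0) = ns ! i" using comb_unit[of j ns] by simp
    then show False
      using that ij by (auto simp: irredundant_def dest!: spec[of _ i] spec[of _ "\<lambda>k. if k = j then 1 else 0"])
  qed
  show ?thesis
  proof
    assume i: "irredundant ns"
    have "e \<notin> \<langle>set ns - {e}\<rangle>" if "e \<in> set ns" for e
      using that gen[OF dist[OF i]] i unfolding irredundant_def in_set_conv_nth by metis
    then show "distinct ns \<and> minimally_generates (set ns) \<langle>set ns\<rangle>"
      using dist[OF i] by (simp add: minimally_generates_def)
  next
    assume "distinct ns \<and> minimally_generates (set ns) \<langle>set ns\<rangle>"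
    then show "irredundant ns"
      using gen nth_mem unfolding irredundant_def minimally_generates_def by metis
  qed
qed

lemma irredundantD: "irredundant ns \<Longrightarrow> i < length ns \<Longrightarrow> \<alpha> i = 0 \<Longrightarrow> comb ns \<alpha> \<noteq> ns ! i"
  by (simp add: irredundant_def)

lemma cancellative_comb:
  assumes "cancellative \<langle>set ns\<rangle>" "comb ns \<alpha> + comb ns \<beta> = comb ns \<alpha> + comb ns \<beta>'"
  shows "comb ns \<beta> = comb ns \<beta>'"
  using assms comb_in_sgp_gen[of ns \<alpha>] comb_in_sgp_gen[of ns \<beta>] comb_in_sgp_gen[of ns \<beta>']
  unfolding cancellative_def by simp

text \<open>If generator \<open>i\<close> occurred, splitting off one copy would make the rest its
  negative. Reducedness then forces \<open>ns ! i = 0\<close>, but zero is the empty combination,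
  against irredundance.\<close>

lemma reduced_comb_eq_0:
  assumes "reduced \<langle>set ns\<rangle>" "irredundant ns" "comb ns \<alpha> = 0" "i < length ns"
  shows "\<alpha> i = 0"
proof (rule ccontr)
  assume n: "\<alpha> i \<noteq> 0"
  have "comb ns \<alpha> = comb ns (\<lambda>j. (if j = i then 1 else 0) + (\<alpha> j - (if j = i then 1 else 0)))"
    by (rule comb_cong) (use n in auto)
  then have "ns ! i + comb ns (\<lambda>j. \<alpha> j - (if j = i then 1 else 0)) = 0"
    unfolding comb_add using assms(3,4) comb_unit[of i ns] by simp
  moreover have "ns ! i \<in> \<langle>set ns\<rangle>" using comb_in_sgp_gen comb_unit[OF assms(4)] by metis
  ultimately have "ns ! i = 0"
    using assms(1) comb_in_sgp_gen[of ns] unfolding reduced_def by blast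
  then show False using irredundantD[OF assms(2,4), of "\<lambda>_. 0"] by simp
qed

lemma torsion_freeD_comb:
  "torsion_free \<langle>set ns\<rangle> \<Longrightarrow> k > 0 \<Longrightarrow> comb ns (\<lambda>i. k * \<alpha> i) = comb ns (\<lambda>i. k * \<beta> i)
    \<Longrightarrow> comb ns \<alpha> = comb ns \<beta>"
  using comb_in_sgp_gen[of ns \<alpha>] comb_in_sgp_gen[of ns \<beta>]
  unfolding torsion_free_def comb_mult by simp

lemma torsion_freeI_comb:
  assumes "\<And>k \<alpha> \<beta>. k > 0 \<Longrightarrow> comb ns (\<lambda>i. k * \<alpha> i) = comb ns (\<lambda>i. k * \<beta> i)
    \<Longrightarrow> comb ns \<alpha> = comb ns \<beta>"
  shows "torsion_free \<langle>set ns\<rangle>"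
  unfolding torsion_free_def
proof (intro allI impI ballI)
  fix k :: nat and x y
  assume k: "0 < k" and xy: "x \<in> \<langle>set ns\<rangle>" "y \<in> \<langle>set ns\<rangle>" and e: "nmult k x = nmult k y"
  obtain \<alpha> \<beta> where "x = comb ns \<alpha>" "y = comb ns \<beta>" using xy unfolding sgp_gen_set_iff by metis
  then show "x = y" using assms[OF k, of \<alpha> \<beta>] e by (simp add: comb_mult)
qed

section \<open>Kernel vectors as differences of exponents\<close>

definition int_vec :: "nat \<Rightarrow> (nat \<Rightarrow> nat) \<Rightarrow> int vec" where
  "int_vec n \<alpha> = vec n (\<lambda>i. int (\<alpha> i))"

lemma int_vec_carrier [simp]: "int_vec n \<alpha> \<in> carrier_vec n"
  and int_vec_index [simp]: "i < n \<Longrightarrow> int_vec n \<alpha> $ i = int (\<alpha> i)"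
  and dim_int_vec [simp]: "dim_vec (int_vec n \<alpha>) = n"
  by (simp_all add: int_vec_def)

lemma int_vec_diff_cases:
  assumes "x \<in> carrier_vec n"
  obtains \<alpha> \<beta> where "x = int_vec n \<alpha> - int_vec n \<beta>"
proof
  show "x = int_vec n (\<lambda>i. nat (x $ i)) - int_vec n (\<lambda>i. nat (- x $ i))"
    using assms by (intro eq_vecI) auto
qed

lemma nat_int_diff: "nat (int a - int b) = a - b"
  by linarith

text \<open>\<open>ker_sgp\<close> compares the positive and the negative part of a vector. For a
  difference of exponents these are the truncated differences, and adding the pointwise minimum to
  both sides recovers the exponents; cancellation makes this reversible.\<close>

lemma int_vec_diff_in_ker_iff:
  assumes c: "cancellative \<langle>set ns\<rangle>" and n: "n = length ns"
  shows "int_vec n \<alpha> - int_vec n \<beta> \<in> ker_sgp ns \<longleftrightarrow> comb ns \<alpha> = comb ns \<beta>"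
proof -
  have 1: "comb ns \<alpha> = comb ns (\<lambda>i. min (\<alpha> i) (\<beta> i)) + comb ns (\<lambda>i. \<alpha> i - \<beta> i)"
    unfolding comb_add[symmetric] by (rule comb_cong) auto
  have 2: "comb ns \<beta> = comb ns (\<lambda>i. min (\<alpha> i) (\<beta> i)) + comb ns (\<lambda>i. \<beta> i - \<alpha> i)"
    unfolding comb_add[symmetric] by (rule comb_cong) auto
  have "int_vec n \<alpha> - int_vec n \<beta> \<in> ker_sgp ns \<longleftrightarrow>
      comb ns (\<lambda>i. \<alpha> i - \<beta> i) = comb ns (\<lambda>i. \<beta> i - \<alpha> i)"
    unfolding ker_sgp_def comb_def n by (auto simp: nat_int_diff)
  also have "\<dots> \<longleftrightarrow> comb ns \<alpha> = comb ns \<beta>"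
    using 1 2 cancellative_comb[OF c] by metis
  finally show ?thesis .
qed

text \<open>Saturation of the kernel lattice: with \<open>x\<close> written as a difference of
  exponents, membership of its \<open>k\<close>-fold multiple is an equation between
  \<open>k\<close>-fold elements, from which torsion-freeness removes the factor.\<close>

lemma torsion_free_ker:
  assumes "torsion_free \<langle>set ns\<rangle>" "cancellative \<langle>set ns\<rangle>" "x \<in> carrier_vec (length ns)"
    and "k > 0" "int k \<cdot>\<^sub>v x \<in> ker_sgp ns"
  shows "x \<in> ker_sgp ns"
proof -
  obtain \<alpha> \<beta> where x: "x = int_vec (length ns) \<alpha> - int_vec (length ns) \<beta>"
    using int_vec_diff_cases[OF assms(3)] .
  have "int k \<cdot>\<^sub>v x = int_vec (length ns) (\<lambda>i. k * \<alpha> i) - int_vec (length ns) (\<lambda>i. k * \<beta> i)"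
    unfolding x by (rule eq_vecI) (auto simp: right_diff_distrib)
  then have "comb ns (\<lambda>i. k * \<alpha> i) = comb ns (\<lambda>i. k * \<beta> i)"
    using assms(5) by (simp add: int_vec_diff_in_ker_iff[OF assms(2) refl])
  from torsion_freeD_comb[OF assms(1,4) this] show ?thesis
    unfolding x by (simp add: int_vec_diff_in_ker_iff[OF assms(2) refl])
qed

section \<open>Row lattices and the Smith normal form\<close>

lemma vec_mat_index:
  assumes "j < dim_col M" "dim_vec v = dim_row M"
  shows "vec_mat v M $ j = (\<Sum>i<dim_row M. v $ i * M $$ (i, j))"
proof -
  have "vec_mat v M $ j = (\<Sum>i\<in>{0..<dim_row M}. M $$ (i, j) * v $ i)"
    unfolding vec_mat_def using assms by (simp add: scalar_prod_def)
  also have "\<dots> = (\<Sum>i<dim_row M. v $ i * M $$ (i, j))"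
    unfolding atLeast0LessThan by (rule sum.cong) (simp_all add: mult.commute)
  finally show ?thesis .
qed

lemma vec_mat_carrier: "M \<in> carrier_mat m n \<Longrightarrow> vec_mat v M \<in> carrier_vec n"
  by (rule carrier_vecI) (simp add: vec_mat_def)

lemma dim_vec_mat [simp]: "dim_vec (vec_mat v M) = dim_col M"
  by (simp add: vec_mat_def)

lemma vec_mat_add:
  "M \<in> carrier_mat m n \<Longrightarrow> u \<in> carrier_vec m \<Longrightarrow> v \<in> carrier_vec m
    \<Longrightarrow> vec_mat (u + v) M = vec_mat u M + vec_mat v M"
  unfolding vec_mat_def by (rule mult_add_distrib_mat_vec) auto

lemma vec_mat_minus:
  "M \<in> carrier_mat m n \<Longrightarrow> u \<in> carrier_vec m \<Longrightarrow> v \<in> carrier_vec m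
    \<Longrightarrow> vec_mat (u - v) M = vec_mat u M - vec_mat v M"
  unfolding vec_mat_def by (rule mult_minus_distrib_mat_vec) auto

lemma vec_mat_smult:
  "M \<in> carrier_mat m n \<Longrightarrow> v \<in> carrier_vec m \<Longrightarrow> vec_mat (k \<cdot>\<^sub>v v) M = k \<cdot>\<^sub>v vec_mat v M"
  by (rule eq_vecI) (simp_all add: vec_mat_index sum_distrib_left mult.assoc)

lemma vec_mat_mult:
  assumes "M \<in> carrier_mat m n" "N \<in> carrier_mat n p" "v \<in> carrier_vec m"
  shows "vec_mat v (M * N) = vec_mat (vec_mat v M) N"
proof -
  have "transpose_mat (M * N) = transpose_mat N * transpose_mat M"
    using assms by (intro transpose_mult) auto
  then show ?thesis
    unfolding vec_mat_def using assms by (simp add: assoc_mult_mat_vec[of _ p n _ m])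
qed

text \<open>The determinant is its own inverse, so multiplying the adjugate by it gives an integral
  inverse.\<close>

lemma unimodular_inverse:
  assumes "unimodular n U"
  obtains V where "V \<in> carrier_mat n n" "U * V = 1\<^sub>m n" "V * U = 1\<^sub>m n"
proof -
  have U: "U \<in> carrier_mat n n" and d: "det U * det U = 1"
    using assms by (auto simp: unimodular_def)
  note a = adj_mat[OF U]
  show thesis
  proof (rule that[of "det U \<cdot>\<^sub>m adj_mat U"])
    show "U * (det U \<cdot>\<^sub>m adj_mat U) = 1\<^sub>m n"
      using a U d by (simp add: mult_smult_distrib[of U n n]) (rule eq_matI; auto)
    show "(det U \<cdot>\<^sub>m adj_mat U) * U = 1\<^sub>m n"
      using a U d by (simp add: mult_smult_assoc_mat[of _ n n]) (rule eq_matI; auto)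
  qed (use a in auto)
qed

lemma vec_mat_one [simp]: "v \<in> carrier_vec n \<Longrightarrow> vec_mat v (1\<^sub>m n) = v"
  by (simp add: vec_mat_def)

lemma unimodular_surj:
  assumes "unimodular n U" "w \<in> carrier_vec n"
  obtains v where "v \<in> carrier_vec n" "vec_mat v U = w"
proof -
  obtain V where V: "V \<in> carrier_mat n n" "V * U = 1\<^sub>m n" using unimodular_inverse[OF assms(1)] .
  show thesis
    using that[of "vec_mat w V"] vec_mat_mult[of V n n U n w] V assms
    by (simp add: vec_mat_carrier unimodular_def)
qed

lemma unimodular_inj:
  assumes "unimodular n U" "v \<in> carrier_vec n" "w \<in> carrier_vec n" "vec_mat v U = vec_mat w U"
  shows "v = w"
proof -
  obtain V where V: "V \<in> carrier_mat n n" "U * V = 1\<^sub>m n" using unimodular_inverse[OF assms(1)] .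
  have "vec_mat x (U * V) = vec_mat (vec_mat x U) V" if "x \<in> carrier_vec n" for x
    using vec_mat_mult[of U n n V n x] V assms(1) that by (simp add: unimodular_def)
  then show ?thesis using assms V by (metis vec_mat_one)
qed

text \<open>The coefficient vector is cut along the three blocks of rows. The last row contributes
  its single coefficient \<open>w $ 0\<close> to both halves, with opposite signs.\<close>

lemma vec_mat_glue_mat:
  assumes L1: "L1 \<in> carrier_mat m1 n1" and L2: "L2 \<in> carrier_mat m2 n2"
    and g: "gX \<in> carrier_vec n1" "gY \<in> carrier_vec n2"
    and u: "u \<in> carrier_vec m1" and v: "v \<in> carrier_vec m2" and w: "w \<in> carrier_vec 1"
  shows "vec_mat ((u @\<^sub>v v) @\<^sub>v w) (glue_mat L1 L2 gX gY) =
    (vec_mat u L1 + w $ 0 \<cdot>\<^sub>v gX) @\<^sub>v (vec_mat v L2 - w $ 0 \<cdot>\<^sub>v gY)"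
proof (rule eq_vecI)
  let ?G = "glue_mat L1 L2 gX gY"
  have dims: "dim_row ?G = m1 + m2 + 1" "dim_col ?G = n1 + n2"
    using L1 L2 g by (auto simp: glue_mat_def append_rows_def)
  have ent: "?G $$ (i, j) =
     (if i < m1 then (if j < n1 then L1 $$ (i, j) else 0)
      else if i < m1 + m2 then (if j < n1 then 0 else L2 $$ (i - m1, j - n1))
      else if j < n1 then gX $ j else - gY $ (j - n1))"
    if "i < m1 + m2 + 1" "j < n1 + n2" for i j
    using that L1 L2 g by (auto simp: glue_mat_def append_rows_def)
  fix j assume "j < dim_vec ((vec_mat u L1 + w $ 0 \<cdot>\<^sub>v gX) @\<^sub>v (vec_mat v L2 - w $ 0 \<cdot>\<^sub>v gY))"
  then have j: "j < n1 + n2" using L1 L2 g by simp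
  have split: "(\<Sum>i<m1 + k. f i) = (\<Sum>i<m1. f i) + (\<Sum>i<k. f (m1 + i))" for k and f :: "nat \<Rightarrow> int"
    by (induction k) (simp_all add: add.assoc)
  let ?c = "\<lambda>i. ((u @\<^sub>v v) @\<^sub>v w) $ i * ?G $$ (i, j)"
  have "vec_mat ((u @\<^sub>v v) @\<^sub>v w) ?G $ j = (\<Sum>i<m1 + m2 + 1. ?c i)"
    using vec_mat_index[of j ?G "(u @\<^sub>v v) @\<^sub>v w"] j dims u v w by simp
  also have "\<dots> = (\<Sum>i<m1. ?c i) + (\<Sum>i<m2. ?c (m1 + i)) + ?c (m1 + m2)"
    by (simp add: split)
  also have "(\<Sum>i<m1. ?c i) = (\<Sum>i<m1. u $ i * (if j < n1 then L1 $$ (i, j) else 0))"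
    by (rule sum.cong) (use u v w j in \<open>auto simp: ent\<close>)
  also have "(\<Sum>i<m2. ?c (m1 + i)) = (\<Sum>i<m2. v $ i * (if j < n1 then 0 else L2 $$ (i, j - n1)))"
    by (rule sum.cong) (use u v w j in \<open>auto simp: ent\<close>)
  also have "?c (m1 + m2) = w $ 0 * (if j < n1 then gX $ j else - gY $ (j - n1))"
    using u v w j by (simp add: ent)
  also have "(\<Sum>i<m1. u $ i * (if j < n1 then L1 $$ (i, j) else 0)) +
      (\<Sum>i<m2. v $ i * (if j < n1 then 0 else L2 $$ (i, j - n1))) +
      w $ 0 * (if j < n1 then gX $ j else - gY $ (j - n1)) =
    ((vec_mat u L1 + w $ 0 \<cdot>\<^sub>v gX) @\<^sub>v (vec_mat v L2 - w $ 0 \<cdot>\<^sub>v gY)) $ j"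
    using L1 L2 g u v j by (simp add: vec_mat_index)
  finally show "vec_mat ((u @\<^sub>v v) @\<^sub>v w) ?G $ j =
    ((vec_mat u L1 + w $ 0 \<cdot>\<^sub>v gX) @\<^sub>v (vec_mat v L2 - w $ 0 \<cdot>\<^sub>v gY)) $ j" .
next
  show "dim_vec (vec_mat ((u @\<^sub>v v) @\<^sub>v w) (glue_mat L1 L2 gX gY)) =
    dim_vec ((vec_mat u L1 + w $ 0 \<cdot>\<^sub>v gX) @\<^sub>v (vec_mat v L2 - w $ 0 \<cdot>\<^sub>v gY))"
    using L1 L2 g by (simp add: glue_mat_def append_rows_def)
qed

text \<open>The multiplier \<open>c\<close> is the coefficient of the last row. Once its
  contribution is removed, the two diagonal blocks can be treated separately.\<close>

lemma append_in_row_lattice_glue_mat_iff: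
  assumes g: "gX \<in> carrier_vec (dim_col L1)" "gY \<in> carrier_vec (dim_col L2)"
    and x: "x \<in> carrier_vec (dim_col L1)" and y: "y \<in> carrier_vec (dim_col L2)"
  shows "x @\<^sub>v y \<in> row_lattice (glue_mat L1 L2 gX gY) \<longleftrightarrow>
    (\<exists>c. x - c \<cdot>\<^sub>v gX \<in> row_lattice L1 \<and> y + c \<cdot>\<^sub>v gY \<in> row_lattice L2)"
proof -
  let ?m1 = "dim_row L1" and ?m2 = "dim_row L2"
  have L: "L1 \<in> carrier_mat ?m1 (dim_col L1)" "L2 \<in> carrier_mat ?m2 (dim_col L2)" by auto
  have rows: "dim_row (glue_mat L1 L2 gX gY) = ?m1 + ?m2 + 1"
    by (simp add: glue_mat_def append_rows_def)
  note glue = vec_mat_glue_mat[OF L g]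
  show ?thesis
  proof
    assume "x @\<^sub>v y \<in> row_lattice (glue_mat L1 L2 gX gY)"
    then obtain c where c: "c \<in> carrier_vec (?m1 + ?m2 + 1)" "vec_mat c (glue_mat L1 L2 gX gY) = x @\<^sub>v y"
      unfolding row_lattice_def rows by auto
    define uv w u v where "uv = vec_first c (?m1 + ?m2)" "w = vec_last c 1"
      "u = vec_first uv ?m1" "v = vec_last uv ?m2"
    have u: "u \<in> carrier_vec ?m1" "v \<in> carrier_vec ?m2" "w \<in> carrier_vec 1"
      by (simp_all add: uv_w_u_v_def)
    have "c = (u @\<^sub>v v) @\<^sub>v w" using c by (simp add: uv_w_u_v_def)
    then have "(vec_mat u L1 + w $ 0 \<cdot>\<^sub>v gX) @\<^sub>v (vec_mat v L2 - w $ 0 \<cdot>\<^sub>v gY) = x @\<^sub>v y"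
      using glue[OF u] c by simp
    then have "vec_mat u L1 + w $ 0 \<cdot>\<^sub>v gX = x" "vec_mat v L2 - w $ 0 \<cdot>\<^sub>v gY = y"
      using append_vec_eq[of "vec_mat u L1 + w $ 0 \<cdot>\<^sub>v gX" "dim_col L1" x] g x by (auto simp: vec_mat_carrier[OF L(1)])
    then have "x - w $ 0 \<cdot>\<^sub>v gX = vec_mat u L1" "y + w $ 0 \<cdot>\<^sub>v gY = vec_mat v L2"
      using g by (auto intro!: eq_vecI)
    then show "\<exists>c. x - c \<cdot>\<^sub>v gX \<in> row_lattice L1 \<and> y + c \<cdot>\<^sub>v gY \<in> row_lattice L2"
      using u by (auto simp: row_lattice_def)
  next
    assume "\<exists>c. x - c \<cdot>\<^sub>v gX \<in> row_lattice L1 \<and> y + c \<cdot>\<^sub>v gY \<in> row_lattice L2"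
    then obtain c u v where u: "u \<in> carrier_vec ?m1" "v \<in> carrier_vec ?m2"
      and e: "x - c \<cdot>\<^sub>v gX = vec_mat u L1" "y + c \<cdot>\<^sub>v gY = vec_mat v L2"
      by (auto simp: row_lattice_def)
    have "x = vec_mat u L1 + c \<cdot>\<^sub>v gX" "y = vec_mat v L2 - c \<cdot>\<^sub>v gY"
      unfolding e[symmetric] using g x y by (auto intro!: eq_vecI)
    then have "x @\<^sub>v y = vec_mat ((u @\<^sub>v v) @\<^sub>v vec 1 (\<lambda>_. c)) (glue_mat L1 L2 gX gY)"
      using glue[OF u, of "vec 1 (\<lambda>_. c)"] by simp
    moreover have "(u @\<^sub>v v) @\<^sub>v vec 1 (\<lambda>_. c) \<in> carrier_vec (?m1 + ?m2 + 1)"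
      using u by (intro append_carrier_vec) auto
    ultimately show "x @\<^sub>v y \<in> row_lattice (glue_mat L1 L2 gX gY)"
      unfolding row_lattice_def rows by blast
  qed
qed

text \<open>In the coordinates given by \<open>Q\<close>, the row lattice of \<open>L\<close> is that of its Smith normal form,
  hence of finite index in the span of the coordinates that precede the zero columns.\<close>

lemma smith_tail_zero:
  assumes P: "unimodular (dim_row L) P" and Q: "unimodular (dim_col L) Q" and D: "D = P * L * Q"
    and z: "zero_cols_right D" and x: "x \<in> row_lattice L"
    and j: "dim_col L - num_zero_cols D \<le> j" "j < dim_col L"
  shows "vec_mat x Q $ j = 0"
proof -
  have Q': "Q \<in> carrier_mat (dim_col L) (dim_col L)" and P': "P \<in> carrier_mat (dim_row L) (dim_row L)"
    using P Q by (auto simp: unimodular_def)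
  have D': "D \<in> carrier_mat (dim_row L) (dim_col L)" unfolding D by (intro mult_carrier_mat[of _ _ "dim_col L"] mult_carrier_mat[of _ _ "dim_row L"] P' Q') auto
  obtain c where c: "c \<in> carrier_vec (dim_row L)" "x = vec_mat c L" using x by (auto simp: row_lattice_def)
  \<comment> \<open>Passing from the rows of \<open>L\<close> to the rows of \<open>P * L\<close>,
    which generate the same lattice, turns \<open>vec_mat x Q\<close> into a combination of the rows
    of \<open>D\<close>.\<close>
  obtain c' where c': "c' \<in> carrier_vec (dim_row L)" "vec_mat c' P = c" using unimodular_surj[OF P c(1)] .
  have L: "L \<in> carrier_mat (dim_row L) (dim_col L)" by simp
  have PL: "P * L \<in> carrier_mat (dim_row L) (dim_col L)" by (rule mult_carrier_mat[OF P' L])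
  have "vec_mat x Q = vec_mat c' D"
    unfolding D vec_mat_mult[OF PL Q' c'(1)] vec_mat_mult[OF P' L c'(1)] c'(2) c(2) ..
  moreover have "col D j = 0\<^sub>v (dim_row D)"
    using z j D' by (auto simp: zero_cols_right_def)
  then have "D $$ (i, j) = 0" if "i < dim_row D" for i
    using that j D' by (metis carrier_matD(2) index_col index_zero_vec(1))
  ultimately show ?thesis using j D' c' by (simp add: vec_mat_index)
qed

lemma smith_multiple_in_row_lattice:
  assumes P: "unimodular (dim_row L) P" and Q: "unimodular (dim_col L) Q" and D: "D = P * L * Q"
    and s: "smith_normal_form D" and z: "zero_cols_right D" and x: "x \<in> carrier_vec (dim_col L)"
    and tail: "\<And>j. dim_col L - num_zero_cols D \<le> j \<Longrightarrow> j < dim_col L \<Longrightarrow> vec_mat x Q $ j = 0"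
  obtains N :: nat where "N > 0" "int N \<cdot>\<^sub>v x \<in> row_lattice L"
proof -
  let ?m = "dim_row L" and ?n = "dim_col L"
  \<comment> \<open>The columns with index below \<open>h\<close> are exactly the nonzero columns of
    \<open>D\<close>.\<close>
  define h where "h = ?n - num_zero_cols D"
  have Q': "Q \<in> carrier_mat ?n ?n" and P': "P \<in> carrier_mat ?m ?m"
    using P Q by (auto simp: unimodular_def)
  have D': "D \<in> carrier_mat ?m ?n" unfolding D by (intro mult_carrier_mat[of _ _ "dim_col L"] mult_carrier_mat[of _ _ "dim_row L"] P' Q') auto
  have off: "D $$ (i, j) = 0" if "i < ?m" "j < ?n" "i \<noteq> j" for i j
    using s that D' by (auto simp: smith_normal_form_def)
  \<comment> \<open>A nonzero column has a nonzero entry, and off the diagonal all entries vanish.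
    So that entry sits at \<open>(j, j)\<close>, and in particular row \<open>j\<close>
    exists.\<close>
  have diag: "j < ?m \<and> D $$ (j, j) \<noteq> 0" if "j < h" for j
  proof -
    have j: "j < ?n" using that by (simp add: h_def)
    have "col D j \<noteq> 0\<^sub>v ?m" using z that j D' by (auto simp: zero_cols_right_def h_def)
    then obtain i where "i < ?m" "D $$ (i, j) \<noteq> 0"
      using D' j by (metis carrier_matD dim_col eq_vecI index_col index_zero_vec)
    then show ?thesis using off j by metis
  qed
  have nonneg: "D $$ (j, j) \<ge> 0" if "j < h" for j
    using s diag[OF that] D' that by (auto simp: smith_normal_form_def h_def)
  \<comment> \<open>A common multiple of the nonzero diagonal entries: it clears all denominators
    when the diagonal system is solved.\<close>
  define N where "N = (\<Prod>j<h. nat (D $$ (j, j)))"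
  have "0 < nat (D $$ (j, j))" if "j < h" for j
    using diag[OF that] nonneg[OF that] by linarith
  then have N: "N > 0" unfolding N_def by (intro prod_pos) blast
  have dvd: "D $$ (j, j) dvd int N" if "j < h" for j
  proof -
    have "nat (D $$ (j, j)) dvd N" unfolding N_def using that by (intro dvd_prodI) auto
    then show ?thesis using nonneg[OF that] by (simp add: int_dvd_int_iff[symmetric])
  qed
  \<comment> \<open>Solves \<open>vec_mat c D = int N \<cdot>\<^sub>v vec_mat x Q\<close> one
    coordinate at a time; past \<open>h\<close> both sides are zero by \<open>tail\<close>.\<close>
  define c where "c = vec ?m (\<lambda>i. if i < h then int N div D $$ (i, i) * vec_mat x Q $ i else 0)"
  have c: "c \<in> carrier_vec ?m" by (simp add: c_def)
  have "vec_mat c D = int N \<cdot>\<^sub>v vec_mat x Q"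
  proof (rule eq_vecI)
    fix j assume "j < dim_vec (int N \<cdot>\<^sub>v vec_mat x Q)"
    then have j: "j < ?n" using Q' by simp
    have "vec_mat c D $ j = (\<Sum>i<?m. c $ i * D $$ (i, j))"
      using j D' c by (simp add: vec_mat_index)
    also have "\<dots> = (\<Sum>i<?m. if i = j then c $ i * D $$ (i, i) else 0)"
      by (rule sum.cong) (use off j in auto)
    also have "\<dots> = (if j < ?m then c $ j * D $$ (j, j) else 0)" by simp
    also have "\<dots> = int N * vec_mat x Q $ j"
      using dvd[of j] diag[of j] tail[of j] j by (auto simp: c_def h_def[symmetric])
    finally show "vec_mat c D $ j = (int N \<cdot>\<^sub>v vec_mat x Q) $ j" using j Q' by simp
  qed (use D' Q' in simp)
  also have "\<dots> = vec_mat (int N \<cdot>\<^sub>v x) Q" using vec_mat_smult[OF Q' x] by simp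
  finally have "vec_mat c D = vec_mat (int N \<cdot>\<^sub>v x) Q" .
  moreover have L: "L \<in> carrier_mat ?m ?n" by simp
  have PL: "P * L \<in> carrier_mat ?m ?n" by (rule mult_carrier_mat[OF P' L])
  have "vec_mat c D = vec_mat (vec_mat (vec_mat c P) L) Q"
    unfolding D vec_mat_mult[OF PL Q' c] vec_mat_mult[OF P' L c] ..
  ultimately have "int N \<cdot>\<^sub>v x = vec_mat (vec_mat c P) L"
    using unimodular_inj[OF Q, of "int N \<cdot>\<^sub>v x" "vec_mat (vec_mat c P) L"] x
    by (simp add: vec_mat_carrier[OF L])
  then have "int N \<cdot>\<^sub>v x \<in> row_lattice L"
    using vec_mat_carrier[OF P'] by (auto simp: row_lattice_def)
  then show thesis using that N by blast
qed

text \<open>Induction with the two-term Bezout identity: the combination found so far is merged with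
  the new entry. Asking for divisibility only, the combination is a gcd up to sign, and the empty
  family is covered.\<close>

lemma bezout_finite_int:
  fixes a :: "'i \<Rightarrow> int"
  assumes "finite I"
  shows "\<exists>f. \<forall>j\<in>I. (\<Sum>i\<in>I. f i * a i) dvd a j"
  using assms
proof (induction I)
  case (insert i I)
  then obtain f where f: "\<forall>j\<in>I. (\<Sum>i\<in>I. f i * a i) dvd a j" by blast
  define d where "d = (\<Sum>i\<in>I. f i * a i)"
  obtain u v where uv: "u * d + v * a i = gcd d (a i)" using bezout_int[of d "a i"] by blast
  have "(\<Sum>j\<in>insert i I. (if j = i then v else u * f j) * a j) =
      v * a i + (\<Sum>j\<in>I. (if j = i then v else u * f j) * a j)"
    using insert.hyps by simp
  also have "(\<Sum>j\<in>I. (if j = i then v else u * f j) * a j) = u * d"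
    unfolding d_def sum_distrib_left using insert.hyps by (intro sum.cong) auto
  finally have "(\<Sum>j\<in>insert i I. (if j = i then v else u * f j) * a j) = gcd d (a i)"
    using uv by simp
  moreover have "gcd d (a i) dvd a j" if "j \<in> insert i I" for j
    using that f unfolding d_def[symmetric] by (auto intro: dvd_trans)
  ultimately show ?case by (intro exI[of _ "\<lambda>j. if j = i then v else u * f j"]) simp
qed simp

section \<open>Semigroup ideals\<close>

lemma poly_ring_carrier_iff: "p \<in> carrier (poly_ring E) \<longleftrightarrow> (\<forall>m\<in>Poly_Mapping.keys p. Poly_Mapping.keys m \<subseteq> E)"
  by (simp add: poly_ring_def)

lemma poly_ring_mono: "E \<subseteq> F \<Longrightarrow> carrier (poly_ring E) \<subseteq> carrier (poly_ring F)"
  by (fastforce simp: poly_ring_carrier_iff)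

lemma poly_ring_ops [simp]:
  "add (poly_ring E) p q = p + q" "mult (poly_ring E) p q = p * q"
  "one (poly_ring E) = 1" "zero (poly_ring E) = 0"
  by (simp_all add: poly_ring_def)

lemma poly_ring_uminus: "p \<in> carrier (poly_ring E) \<Longrightarrow> - p \<in> carrier (poly_ring E)"
  by (simp add: poly_ring_carrier_iff)

lemma poly_ring_minus:
  assumes "p \<in> carrier (poly_ring E)" "q \<in> carrier (poly_ring E)"
  shows "p - q \<in> carrier (poly_ring E)"
proof -
  interpret cring "poly_ring E" by (rule cring_poly_ring)
  show ?thesis using a_closed[OF assms(1) poly_ring_uminus[OF assms(2)]] by simp
qed

lemma xpow_carrier: "Poly_Mapping.keys \<alpha> \<subseteq> E \<Longrightarrow> xpow \<alpha> \<in> carrier (poly_ring E)"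
  by (simp add: poly_ring_carrier_iff xpow_def)

lemma xpow_add: "xpow (\<alpha> + \<beta>) = xpow \<alpha> * xpow \<beta>"
  by (simp add: xpow_def mult_single)

text \<open>Ideals are handled through the type class operations. Closure under negation follows
  from multiplication by \<open>- 1\<close>.\<close>

lemma poly_ring_idealI:
  assumes sub: "I \<subseteq> carrier (poly_ring E)" and z: "0 \<in> I"
    and a: "\<And>p q. p \<in> I \<Longrightarrow> q \<in> I \<Longrightarrow> p + q \<in> I"
    and m: "\<And>p q. p \<in> I \<Longrightarrow> q \<in> carrier (poly_ring E) \<Longrightarrow> q * p \<in> I"
  shows "ideal I (poly_ring E :: ('a, 'k::field) mpoly ring)"
proof -
  interpret cring "poly_ring E :: ('a, 'k) mpoly ring" by (rule cring_poly_ring)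
  have neg: "- p \<in> I" if "p \<in> I" for p
    using m[OF that poly_ring_uminus[OF one_closed]] by simp
  have inv: "\<ominus>\<^bsub>poly_ring E\<^esub> p = - p" if "p \<in> I" for p
    using that sub neg by (intro minus_equality) auto
  show ?thesis
  proof (rule idealI[OF ring_axioms])
    show "subgroup I (add_monoid (poly_ring E))"
      by (rule add.subgroupI) (use sub z a neg inv in \<open>auto simp: a_inv_def\<close>)
  qed (use m in \<open>simp_all add: mult.commute\<close>)
qed

lemma poly_ring_ideal_closed:
  assumes "ideal I (poly_ring E)"
  shows "p \<in> I \<Longrightarrow> q \<in> I \<Longrightarrow> p + q \<in> I"
    and "p \<in> I \<Longrightarrow> q \<in> carrier (poly_ring E) \<Longrightarrow> q * p \<in> I"
    and "p \<in> I \<Longrightarrow> - p \<in> I" and "0 \<in> I" and "I \<subseteq> carrier (poly_ring E)"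
proof -
  interpret ideal I "poly_ring E" by fact
  show a: "p + q \<in> I" if "p \<in> I" "q \<in> I" for p q
    using additive_subgroup.a_closed[OF additive_subgroup_axioms that] by simp
  show m: "q * p \<in> I" if "p \<in> I" "q \<in> carrier (poly_ring E)" for p q using I_l_closed[OF that] by simp
  show "- p \<in> I" if "p \<in> I" using m[OF that poly_ring_uminus[OF one_closed]] by simp
  show "0 \<in> I" using additive_subgroup.zero_closed[OF additive_subgroup_axioms] by simp
  show "I \<subseteq> carrier (poly_ring E)" by (rule a_subset)
qed

definition sgp_binomials :: "'a::comm_monoid_add set \<Rightarrow> ('a, 'k::field) mpoly set" where
  "sgp_binomials E = {xpow \<alpha> - xpow \<beta> | \<alpha> \<beta>.
     Poly_Mapping.keys \<alpha> \<subseteq> E \<and> Poly_Mapping.keys \<beta> \<subseteq> E \<and> sgp_value \<alpha> = sgp_value \<beta>}"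

lemma sgp_binomialsI:
  "Poly_Mapping.keys \<alpha> \<subseteq> E \<Longrightarrow> Poly_Mapping.keys \<beta> \<subseteq> E \<Longrightarrow> sgp_value \<alpha> = sgp_value \<beta>
    \<Longrightarrow> xpow \<alpha> - xpow \<beta> \<in> sgp_binomials E"
  by (auto simp: sgp_binomials_def)

lemma sgp_ideal_alt: "sgp_ideal E = genideal (poly_ring E) (sgp_binomials E)"
  by (simp add: sgp_ideal_def sgp_binomials_def)

lemma sgp_binomials_carrier: "sgp_binomials E \<subseteq> carrier (poly_ring E)"
  by (auto simp: sgp_binomials_def intro!: poly_ring_minus xpow_carrier)

lemma sgp_ideal_ideal: "ideal (sgp_ideal E) (poly_ring E)"
  unfolding sgp_ideal_alt
  by (intro ring.genideal_ideal sgp_binomials_carrier cring.axioms(1) cring_poly_ring)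

lemma sgp_binomials_subset_ideal: "sgp_binomials E \<subseteq> sgp_ideal E"
  unfolding sgp_ideal_alt
  by (intro ring.genideal_self sgp_binomials_carrier cring.axioms(1) cring_poly_ring)

text \<open>The two ideals live in different rings. The larger one, cut down to the polynomials in
  \<open>E\<close>, is an ideal of the smaller ring that contains all generating binomials, so
  minimality applies.\<close>

lemma sgp_ideal_mono:
  assumes "E \<subseteq> F"
  shows "(sgp_ideal E :: ('a::comm_monoid_add, 'k::field) mpoly set) \<subseteq> sgp_ideal F"
proof -
  let ?I = "sgp_ideal F \<inter> carrier (poly_ring E) :: ('a, 'k) mpoly set"
  interpret E: cring "poly_ring E :: ('a, 'k) mpoly ring" by (rule cring_poly_ring)
  note F = poly_ring_ideal_closed[OF sgp_ideal_ideal[of F, where ?'b = 'k]]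
  have "ideal ?I (poly_ring E)"
  proof (rule poly_ring_idealI)
    show "0 \<in> ?I" using F(4) E.zero_closed by simp
    show "p + q \<in> ?I" if "p \<in> ?I" "q \<in> ?I" for p q
      using that F(1)[of p q] E.a_closed[of p q] by simp
    show "q * p \<in> ?I" if "p \<in> ?I" "q \<in> carrier (poly_ring E)" for p q
      using that F(2)[of p q] E.m_closed[of q p] poly_ring_mono[OF assms] by auto
  qed simp
  moreover have "(sgp_binomials E :: ('a, 'k) mpoly set) \<subseteq> sgp_binomials F"
    using assms unfolding sgp_binomials_def by blast
  then have "sgp_binomials E \<subseteq> ?I"
    using sgp_binomials_subset_ideal[of F, where ?'b = 'k] sgp_binomials_carrier[of E, where ?'b = 'k] by blast
  ultimately show ?thesis using E.genideal_minimal unfolding sgp_ideal_alt[of E] by blast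
qed

section \<open>Monomials and their semigroup values\<close>

lemma sgp_value_superset:
  assumes "finite F" "Poly_Mapping.keys \<alpha> \<subseteq> F"
  shows "sgp_value \<alpha> = (\<Sum>e\<in>F. nmult (Poly_Mapping.lookup \<alpha> e) e)"
  unfolding sgp_value_def
  by (rule sum.mono_neutral_left) (use assms in \<open>auto simp: in_keys_iff\<close>)

lemma sgp_value_add: "sgp_value (\<alpha> + \<beta>) = sgp_value \<alpha> + sgp_value \<beta>"
proof -
  let ?F = "Poly_Mapping.keys \<alpha> \<union> Poly_Mapping.keys \<beta>"
  have "sgp_value (\<alpha> + \<beta>) = (\<Sum>e\<in>?F. nmult (Poly_Mapping.lookup (\<alpha> + \<beta>) e) e)"
    by (rule sgp_value_superset) (use Poly_Mapping.keys_add[of \<alpha> \<beta>] in auto)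
  also have "\<dots> = (\<Sum>e\<in>?F. nmult (Poly_Mapping.lookup \<alpha> e) e) + (\<Sum>e\<in>?F. nmult (Poly_Mapping.lookup \<beta> e) e)"
    by (simp add: lookup_add nmult_add sum.distrib)
  also have "\<dots> = sgp_value \<alpha> + sgp_value \<beta>"
    by (simp add: sgp_value_superset[of ?F])
  finally show ?thesis .
qed

text \<open>The monomial belonging to a coefficient function on indices. As a sum of single
  exponents it adds up the coefficients of repeated entries, so its value is
  \<open>comb ns \<alpha>\<close> even for lists that are not distinct.\<close>

definition expo :: "'a::comm_monoid_add list \<Rightarrow> (nat \<Rightarrow> nat) \<Rightarrow> 'a \<Rightarrow>\<^sub>0 nat" where
  "expo ns \<alpha> = (\<Sum>i<length ns. Poly_Mapping.single (ns ! i) (\<alpha> i))"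

lemma keys_expo: "Poly_Mapping.keys (expo ns \<alpha>) \<subseteq> set ns"
proof -
  have "Poly_Mapping.keys (expo ns \<alpha>) \<subseteq> (\<Union>i<length ns. Poly_Mapping.keys (Poly_Mapping.single (ns ! i) (\<alpha> i)))"
    unfolding expo_def by (rule keys_sum)
  also have "\<dots> \<subseteq> set ns" by auto
  finally show ?thesis .
qed

lemma sgp_value_single: "sgp_value (Poly_Mapping.single e k) = nmult k e"
  by (simp add: sgp_value_def)

lemma sgp_value_expo: "sgp_value (expo ns \<alpha>) = comb ns \<alpha>"
proof -
  have "sgp_value (\<Sum>i<m. Poly_Mapping.single (ns ! i) (\<alpha> i)) = (\<Sum>i<m. nmult (\<alpha> i) (ns ! i))" for m
  proof (induction m)
    case 0
    show ?case by (simp add: sgp_value_def)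
  qed (simp add: sgp_value_add sgp_value_single)
  then show ?thesis by (simp add: expo_def comb_def)
qed

lemma expo_add: "expo ns (\<lambda>i. \<alpha> i + \<beta> i) = expo ns \<alpha> + expo ns \<beta>"
  by (simp add: expo_def single_add sum.distrib)

lemma expo_zero: "expo ns (\<lambda>i. 0) = 0"
  by (simp add: expo_def)

text \<open>By distinctness every indeterminate occurs at exactly one position of one of the two
  lists, so its exponent can be read off there.\<close>

lemma expo_split:
  assumes "distinct (ms @ ns)" "Poly_Mapping.keys \<alpha> \<subseteq> set ms \<union> set ns"
  obtains \<beta> \<gamma> where "\<alpha> = expo ms \<beta> + expo ns \<gamma>"
proof -
  let ?s = "\<lambda>e. Poly_Mapping.single e (Poly_Mapping.lookup \<alpha> e)"
  have "\<alpha> = (\<Sum>e\<in>Poly_Mapping.keys \<alpha>. ?s e)"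
    by (rule poly_mapping_eqI)
      (auto simp: lookup_sum lookup_single when_def in_keys_iff if_distrib cong: if_cong)
  also have "\<dots> = (\<Sum>e\<in>set ms \<union> set ns. ?s e)"
    by (rule sum.mono_neutral_left) (use assms(2) in \<open>auto simp: in_keys_iff\<close>)
  also have "\<dots> = (\<Sum>e\<in>set ms. ?s e) + (\<Sum>e\<in>set ns. ?s e)"
    by (rule sum.union_disjoint) (use assms(1) in auto)
  also have "(\<Sum>e\<in>set ms. ?s e) = expo ms (\<lambda>i. Poly_Mapping.lookup \<alpha> (ms ! i))"
    unfolding expo_def using assms(1)
    by (intro sum.reindex_bij_betw[symmetric] bij_betw_nth) auto
  also have "(\<Sum>e\<in>set ns. ?s e) = expo ns (\<lambda>i. Poly_Mapping.lookup \<alpha> (ns ! i))"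
    unfolding expo_def using assms(1)
    by (intro sum.reindex_bij_betw[symmetric] bij_betw_nth) auto
  finally show thesis by (rule that)
qed

text \<open>The sum of ideals lies in the large ideal because its three summands do. For the
  converse, \<open>rel\<close> leads from one monomial of a binomial to the other in three moves:
  change the \<open>B1\<close> part, trade \<open>c\<close> copies of \<open>gx\<close> for
  \<open>c\<close> copies of \<open>gy\<close>, change the \<open>B2\<close> part. Each move stays
  within one summand.\<close>

lemma gluing_ideal:
  fixes B1 B2 :: "'a::comm_monoid_add list"
  assumes dist: "distinct (B1 @ B2)" and g: "comb B1 gx = comb B2 gy"
    and rel: "\<And>\<alpha> \<alpha>' \<beta> \<beta>'. comb B1 \<alpha> + comb B2 \<alpha>' = comb B1 \<beta> + comb B2 \<beta>' \<Longrightarrow>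
      \<exists>c. (comb B1 \<alpha> = comb B1 (\<lambda>i. \<beta> i + c * gx i) \<and> comb B2 (\<lambda>i. \<alpha>' i + c * gy i) = comb B2 \<beta>') \<or>
          (comb B1 (\<lambda>i. \<alpha> i + c * gx i) = comb B1 \<beta> \<and> comb B2 \<alpha>' = comb B2 (\<lambda>i. \<beta>' i + c * gy i))"
  defines "R \<equiv> poly_ring (set B1 \<union> set B2) :: ('a, 'k::field) mpoly ring"
  shows "xpow (expo B1 gx) - xpow (expo B2 gy) \<in> (sgp_ideal (set B1 \<union> set B2) :: ('a, 'k) mpoly set)" (is "?b \<in> ?I")
    and "(sgp_ideal (set B1 \<union> set B2) :: ('a, 'k) mpoly set) =
      Idl\<^bsub>R\<^esub> (sgp_ideal (set B1)) <+>\<^bsub>R\<^esub> Idl\<^bsub>R\<^esub> (sgp_ideal (set B2)) <+>\<^bsub>R\<^esub> Idl\<^bsub>R\<^esub> {xpow (expo B1 gx) - xpow (expo B2 gy)}"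
      (is "_ = ?J1 <+>\<^bsub>R\<^esub> ?J2 <+>\<^bsub>R\<^esub> ?J3")
proof -
  let ?E = "set B1 \<union> set B2"
  let ?J = "?J1 <+>\<^bsub>R\<^esub> ?J2 <+>\<^bsub>R\<^esub> ?J3"
  let ?x = "\<lambda>\<alpha>. xpow (expo B1 \<alpha>) :: ('a, 'k) mpoly" and ?y = "\<lambda>\<alpha>. xpow (expo B2 \<alpha>) :: ('a, 'k) mpoly"
  interpret R: cring R unfolding R_def by (rule cring_poly_ring)
  have k: "Poly_Mapping.keys (expo B1 \<alpha>) \<subseteq> ?E" "Poly_Mapping.keys (expo B2 \<alpha>) \<subseteq> ?E" for \<alpha>
    using keys_expo[of B1 \<alpha>] keys_expo[of B2 \<alpha>] by auto
  have car: "?x \<alpha> \<in> carrier R" "?y \<alpha> \<in> carrier R" for \<alpha>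
    unfolding R_def by (rule xpow_carrier, rule k)+
  note I = sgp_ideal_ideal[of ?E, where ?'b = 'k, folded R_def]
  note I' = poly_ring_ideal_closed[OF I[unfolded R_def], folded R_def]
  have "?b \<in> sgp_binomials ?E"
    by (intro sgp_binomialsI k) (simp add: g sgp_value_expo)
  then show b: "?b \<in> ?I" using sgp_binomials_subset_ideal by blast
  have sub: "sgp_ideal (set B1) \<subseteq> ?I" "sgp_ideal (set B2) \<subseteq> ?I" "{?b} \<subseteq> ?I"
    by (rule sgp_ideal_mono, simp)+ (use b in simp)
  then have subR: "sgp_ideal (set B1) \<subseteq> carrier R" "sgp_ideal (set B2) \<subseteq> carrier R" "{?b} \<subseteq> carrier R"
    using I'(5) by blast+
  have id: "ideal ?J1 R" "ideal ?J2 R" "ideal ?J3 R"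
    using subR by (simp_all only: R.genideal_ideal)
  have J: "ideal ?J R" using R.add_ideals R.add_ideals id by blast
  note J' = poly_ring_ideal_closed[OF J[unfolded R_def], folded R_def]
  have le: "?J1 \<subseteq> ?I" "?J2 \<subseteq> ?I" "?J3 \<subseteq> ?I"
    using R.genideal_minimal[OF I] sub by blast+
  \<comment> \<open>Sums of ideals are unfolded to ordinary sums of polynomials; each summand lies
    in the total because the others contain zero.\<close>
  have sa: "A <+>\<^bsub>R\<^esub> B = {a + b | a b. a \<in> A \<and> b \<in> B}" for A B
    unfolding set_add_def' by (auto simp: R_def)
  have z: "0 \<in> ?J1" "0 \<in> ?J2" "0 \<in> ?J3"
    using poly_ring_ideal_closed(4)[OF id(1)[unfolded R_def], folded R_def]
      poly_ring_ideal_closed(4)[OF id(2)[unfolded R_def], folded R_def]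
      poly_ring_ideal_closed(4)[OF id(3)[unfolded R_def], folded R_def] .
  have sl: "A \<subseteq> A <+>\<^bsub>R\<^esub> B" if "0 \<in> B" for A B
    using that unfolding sa by force
  have sr: "B \<subseteq> A <+>\<^bsub>R\<^esub> B" if "0 \<in> A" for A B
    using that unfolding sa by force
  have z12: "0 \<in> ?J1 <+>\<^bsub>R\<^esub> ?J2" using z sl by blast
  have ge: "?J1 \<subseteq> ?J" "?J2 \<subseteq> ?J" "?J3 \<subseteq> ?J"
    using subset_trans[OF sl[OF z(2)] sl[OF z(3)]] subset_trans[OF sr[OF z(1)] sl[OF z(3)]] sr[OF z12] .
  have x: "?x \<alpha> - ?x \<beta> \<in> ?J" if "comb B1 \<alpha> = comb B1 \<beta>" for \<alpha> \<beta>
  proof -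
    have "?x \<alpha> - ?x \<beta> \<in> sgp_binomials (set B1)"
      by (intro sgp_binomialsI keys_expo) (simp add: that sgp_value_expo)
    then show ?thesis using sgp_binomials_subset_ideal R.genideal_self[OF subR(1)] ge by blast
  qed
  have y: "?y \<alpha> - ?y \<beta> \<in> ?J" if "comb B2 \<alpha> = comb B2 \<beta>" for \<alpha> \<beta>
  proof -
    have "?y \<alpha> - ?y \<beta> \<in> sgp_binomials (set B2)"
      by (intro sgp_binomialsI keys_expo) (simp add: that sgp_value_expo)
    then show ?thesis using sgp_binomials_subset_ideal R.genideal_self[OF subR(2)] ge by blast
  qed
  have bJ: "?x gx - ?y gy \<in> ?J" using R.genideal_self[OF subR(3)] ge by blast
  have xs: "?x (\<lambda>i. \<alpha> i + \<beta> i) = ?x \<alpha> * ?x \<beta>" "?y (\<lambda>i. \<alpha> i + \<beta> i) = ?y \<alpha> * ?y \<beta>" for \<alpha> \<beta>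
    by (simp_all add: expo_add xpow_add)
  \<comment> \<open>Telescoping of a difference of powers, one factor of the gluing binomial at a
    time.\<close>
  have pow: "?x (\<lambda>i. c * gx i) - ?y (\<lambda>i. c * gy i) \<in> ?J" for c
  proof (induction c)
    case 0
    show ?case using J'(4) by (simp add: expo_zero)
  next
    case (Suc c)
    have "?x (\<lambda>i. Suc c * gx i) - ?y (\<lambda>i. Suc c * gy i) =
        ?x gx * (?x (\<lambda>i. c * gx i) - ?y (\<lambda>i. c * gy i)) + ?y (\<lambda>i. c * gy i) * (?x gx - ?y gy)"
      by (simp add: xs algebra_simps)
    then show ?case using J'(1) J'(2) Suc bJ car by metis
  qed
  have half: "?x \<alpha> * ?y \<alpha>' - ?x \<beta> * ?y \<beta>' \<in> ?J"
    if "comb B1 \<alpha> = comb B1 (\<lambda>i. \<beta> i + c * gx i)" "comb B2 (\<lambda>i. \<alpha>' i + c * gy i) = comb B2 \<beta>'"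
    for \<alpha> \<alpha>' \<beta> \<beta>' c
  proof -
    \<comment> \<open>The intermediate monomials are
      \<open>?x \<beta> * ?x (\<lambda>i. c * gx i) * ?y \<alpha>'\<close> and
      \<open>?x \<beta> * ?y (\<lambda>i. \<alpha>' i + c * gy i)\<close>.\<close>
    have "?x \<alpha> * ?y \<alpha>' - ?x \<beta> * ?y \<beta>' =
      ?y \<alpha>' * (?x \<alpha> - ?x (\<lambda>i. \<beta> i + c * gx i)) +
      (?x \<beta> * (?y \<alpha>' * (?x (\<lambda>i. c * gx i) - ?y (\<lambda>i. c * gy i))) +
       ?x \<beta> * (?y (\<lambda>i. \<alpha>' i + c * gy i) - ?y \<beta>'))"
      by (simp add: xs algebra_simps)
    also have "\<dots> \<in> ?J"
      by (intro J'(1) J'(2) x y pow car that)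
    finally show ?thesis .
  qed
  have "sgp_binomials ?E \<subseteq> ?J"
  proof
    fix p :: "('a, 'k) mpoly" assume "p \<in> sgp_binomials ?E"
    then obtain a b where p: "p = xpow a - xpow b" and ab: "Poly_Mapping.keys a \<subseteq> ?E"
        "Poly_Mapping.keys b \<subseteq> ?E" and v: "sgp_value a = sgp_value b"
      by (auto simp: sgp_binomials_def)
    obtain \<alpha> \<alpha>' where a: "a = expo B1 \<alpha> + expo B2 \<alpha>'" using expo_split[OF dist ab(1)] .
    obtain \<beta> \<beta>' where b: "b = expo B1 \<beta> + expo B2 \<beta>'" using expo_split[OF dist ab(2)] .
    have pe: "p = ?x \<alpha> * ?y \<alpha>' - ?x \<beta> * ?y \<beta>'" by (simp add: p a b xpow_add)
    have "comb B1 \<alpha> + comb B2 \<alpha>' = comb B1 \<beta> + comb B2 \<beta>'"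
      using v by (simp add: a b sgp_value_add sgp_value_expo)
    from rel[OF this] obtain c where
      "(comb B1 \<alpha> = comb B1 (\<lambda>i. \<beta> i + c * gx i) \<and> comb B2 (\<lambda>i. \<alpha>' i + c * gy i) = comb B2 \<beta>') \<or>
       (comb B1 (\<lambda>i. \<alpha> i + c * gx i) = comb B1 \<beta> \<and> comb B2 \<alpha>' = comb B2 (\<lambda>i. \<beta>' i + c * gy i))"
      by blast
    then show "p \<in> ?J"
    proof
      assume "comb B1 \<alpha> = comb B1 (\<lambda>i. \<beta> i + c * gx i) \<and> comb B2 (\<lambda>i. \<alpha>' i + c * gy i) = comb B2 \<beta>'"
      then show ?thesis unfolding pe using half by blast
    next
      assume "comb B1 (\<lambda>i. \<alpha> i + c * gx i) = comb B1 \<beta> \<and> comb B2 \<alpha>' = comb B2 (\<lambda>i. \<beta>' i + c * gy i)"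
      \<comment> \<open>The second alternative is the first one with the two monomials exchanged,
        hence only a change of sign.\<close>
      then have "?x \<beta> * ?y \<beta>' - ?x \<alpha> * ?y \<alpha>' \<in> ?J" by (intro half[of _ _ c]) simp_all
      then show ?thesis unfolding pe using J'(3) by (metis minus_diff_eq)
    qed
  qed
  then have "?I \<subseteq> ?J"
    using R.genideal_minimal[OF J] unfolding sgp_ideal_alt[of ?E] R_def[symmetric] by blast
  moreover have "?J \<subseteq> ?I"
    unfolding sa using le by (blast intro: I'(1))
  ultimately show "?I = ?J" by blast
qed

section \<open>Semigroups related by gluing\<close>

text \<open>The lattice hypothesis without matrices: \<open>A1\<close> and \<open>A2\<close>
  generate the two given semigroups, \<open>B1\<close> and \<open>B2\<close> together generate the
  glued one. The integer multiplier of the gluing row is split by its sign into two alternatives, so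
  that only natural coefficients occur.\<close>

locale glue_relation =
  fixes A1 :: "'a::comm_monoid_add list" and A2 :: "'b::comm_monoid_add list"
    and B1 B2 :: "'c::comm_monoid_add list" and gx gy :: "nat \<Rightarrow> nat"
  assumes length1: "length B1 = length A1" and length2: "length B2 = length A2"
    and canc1: "cancellative \<langle>set A1\<rangle>" and canc2: "cancellative \<langle>set A2\<rangle>"
    and red1: "reduced \<langle>set A1\<rangle>" and red2: "reduced \<langle>set A2\<rangle>"
    and irr1: "irredundant A1" and irr2: "irredundant A2"
    and gx_nz: "\<exists>i<length A1. gx i \<noteq> 0" and gy_nz: "\<exists>i<length A2. gy i \<noteq> 0"
    and glue: "\<And>\<alpha> \<alpha>' \<beta> \<beta>'. comb B1 \<alpha> + comb B2 \<alpha>' = comb B1 \<beta> + comb B2 \<beta>' \<longleftrightarrow>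
      (\<exists>c. (comb A1 \<alpha> = comb A1 (\<lambda>i. \<beta> i + c * gx i) \<and> comb A2 (\<lambda>i. \<alpha>' i + c * gy i) = comb A2 \<beta>') \<or>
          (comb A1 (\<lambda>i. \<alpha> i + c * gx i) = comb A1 \<beta> \<and> comb A2 \<alpha>' = comb A2 (\<lambda>i. \<beta>' i + c * gy i)))"

text \<open>Exchanging the two sides negates the gluing row and so exchanges the two alternatives.
  Facts about the first side thereby transfer to the second.\<close>

lemma (in glue_relation) swap: "glue_relation A2 A1 B2 B1 gy gx"
proof
  fix \<alpha> \<alpha>' \<beta> \<beta>'
  show "comb B2 \<alpha> + comb B1 \<alpha>' = comb B2 \<beta> + comb B1 \<beta>' \<longleftrightarrow>
      (\<exists>c. (comb A2 \<alpha> = comb A2 (\<lambda>i. \<beta> i + c * gy i) \<and> comb A1 (\<lambda>i. \<alpha>' i + c * gx i) = comb A1 \<beta>') \<or>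
          (comb A2 (\<lambda>i. \<alpha> i + c * gy i) = comb A2 \<beta> \<and> comb A1 \<alpha>' = comb A1 (\<lambda>i. \<beta>' i + c * gx i)))"
    unfolding add.commute[of "comb B2 _"] glue by (intro ex_cong1) blast
qed (fact length1 length2 canc1 canc2 red1 red2 irr1 irr2 gx_nz gy_nz)+

context glue_relation
begin

text \<open>Cancelling \<open>\<alpha>\<close> leaves a zero combination; reducedness makes all its
  coefficients zero, although \<open>gx\<close> has a nonzero entry.\<close>

lemma gx_absorb:
  assumes "comb A1 (\<lambda>i. \<alpha> i + c * gx i) = comb A1 \<alpha>"
  shows "c = 0"
proof -
  have "comb A1 \<alpha> + comb A1 (\<lambda>i. c * gx i) = comb A1 \<alpha> + comb A1 (\<lambda>i. 0)"
    using assms unfolding comb_add by simp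
  then have "comb A1 (\<lambda>i. c * gx i) = 0" using cancellative_comb[OF canc1] by fastforce
  moreover obtain i where "i < length A1" "gx i \<noteq> 0" using gx_nz by blast
  ultimately show ?thesis using reduced_comb_eq_0[OF red1 irr1, of "\<lambda>i. c * gx i" i] by simp
qed

lemma gy_absorb: "comb A2 (\<lambda>i. \<alpha> i + c * gy i) = comb A2 \<alpha> \<Longrightarrow> c = 0"
  by (rule glue_relation.gx_absorb[OF swap])

text \<open>\<open>B1\<close> generates a copy of the semigroup of \<open>A1\<close> inside the
  glued one: a relation without \<open>B2\<close> part would have to absorb \<open>c\<close> copies
  of \<open>gy\<close> into zero, so \<open>c = 0\<close>.\<close>

lemma comb_B1_eq_iff: "comb B1 \<alpha> = comb B1 \<beta> \<longleftrightarrow> comb A1 \<alpha> = comb A1 \<beta>"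
proof
  assume "comb B1 \<alpha> = comb B1 \<beta>"
  then have "comb B1 \<alpha> + comb B2 (\<lambda>i. 0) = comb B1 \<beta> + comb B2 (\<lambda>i. 0)" by simp
  then obtain c where c: "(comb A1 \<alpha> = comb A1 (\<lambda>i. \<beta> i + c * gx i) \<and> comb A2 (\<lambda>i. 0 + c * gy i) = comb A2 (\<lambda>i. 0)) \<or>
          (comb A1 (\<lambda>i. \<alpha> i + c * gx i) = comb A1 \<beta> \<and> comb A2 (\<lambda>i. 0) = comb A2 (\<lambda>i. 0 + c * gy i))"
    unfolding glue by blast
  then have "c = 0" using gy_absorb[of "\<lambda>i. 0" c] by metis
  then show "comb A1 \<alpha> = comb A1 \<beta>" using c by auto
next
  assume "comb A1 \<alpha> = comb A1 \<beta>"
  then have "comb B1 \<alpha> + comb B2 (\<lambda>i. 0) = comb B1 \<beta> + comb B2 (\<lambda>i. 0)"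
    unfolding glue by (intro exI[of _ 0]) simp
  then show "comb B1 \<alpha> = comb B1 \<beta>" by simp
qed

lemma comb_B2_eq_iff: "comb B2 \<alpha> = comb B2 \<beta> \<longleftrightarrow> comb A2 \<alpha> = comb A2 \<beta>"
  by (rule glue_relation.comb_B1_eq_iff[OF swap])

lemma comb_gx_eq_comb_gy: "comb B1 gx = comb B2 gy"
proof -
  have "comb B1 gx + comb B2 (\<lambda>i. 0) = comb B1 (\<lambda>i. 0) + comb B2 gy"
    unfolding glue by (intro exI[of _ 1]) simp
  then show ?thesis by simp
qed

section \<open>Torsion-freeness of the glued semigroup\<close>

lemma glued_torsion_freeD:
  assumes "torsion_free \<langle>set B1 \<union> set B2\<rangle>" "k > 0"
    and "comb B1 (\<lambda>i. k * \<alpha> i) + comb B2 (\<lambda>i. k * \<alpha>' i) = comb B1 (\<lambda>i. k * \<beta> i) + comb B2 (\<lambda>i. k * \<beta>' i)"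
  shows "comb B1 \<alpha> + comb B2 \<alpha>' = comb B1 \<beta> + comb B2 \<beta>'"
proof -
  have nm: "nmult k (comb B1 \<alpha> + comb B2 \<alpha>') = comb B1 (\<lambda>i. k * \<alpha> i) + comb B2 (\<lambda>i. k * \<alpha>' i)" for \<alpha> \<alpha>'
    unfolding comb_mult by (simp add: nmult_def sum.distrib)
  have mem: "comb B1 \<alpha> + comb B2 \<alpha>' \<in> \<langle>set B1 \<union> set B2\<rangle>" for \<alpha> \<alpha>'
    using comb_in_sgp_gen[of "B1 @ B2"] comb_split_append[of B1 B2 \<alpha> \<alpha>', symmetric] by simp
  show ?thesis
    using assms mem[of \<alpha> \<alpha>'] mem[of \<beta> \<beta>'] unfolding torsion_free_def nm[symmetric] by simp
qed

lemma torsion_free_A1: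
  assumes "torsion_free \<langle>set B1 \<union> set B2\<rangle>"
  shows "torsion_free \<langle>set A1\<rangle>"
proof (rule torsion_freeI_comb)
  fix k :: nat and \<alpha> \<beta>
  assume k: "k > 0" and e: "comb A1 (\<lambda>i. k * \<alpha> i) = comb A1 (\<lambda>i. k * \<beta> i)"
  have "comb B1 \<alpha> + comb B2 (\<lambda>i. 0) = comb B1 \<beta> + comb B2 (\<lambda>i. 0)"
    by (rule glued_torsion_freeD[OF assms k]) (use e in \<open>simp add: comb_B1_eq_iff\<close>)
  then show "comb A1 \<alpha> = comb A1 \<beta>" by (simp add: comb_B1_eq_iff)
qed

lemma torsion_free_A2: "torsion_free \<langle>set B1 \<union> set B2\<rangle> \<Longrightarrow> torsion_free \<langle>set A2\<rangle>"
  using glue_relation.torsion_free_A1[OF swap] by (simp add: Un_commute)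

text \<open>The functionals \<open>\<phi>\<close> and \<open>\<psi>\<close> turn a relation between \<open>k\<close>-fold elements that uses \<open>c\<close> copies of
  the gluing relation into an equation showing that \<open>k\<close> divides \<open>c\<close>.\<close>

lemma glued_torsion_freeI:
  fixes \<phi> \<psi> :: "(nat \<Rightarrow> nat) \<Rightarrow> int"
  assumes tf: "torsion_free \<langle>set A1\<rangle>" "torsion_free \<langle>set A2\<rangle>"
    and inv: "\<And>\<alpha> \<beta>. comb A1 \<alpha> = comb A1 \<beta> \<Longrightarrow> \<phi> \<alpha> = \<phi> \<beta>" "\<And>\<alpha> \<beta>. comb A2 \<alpha> = comb A2 \<beta> \<Longrightarrow> \<psi> \<alpha> = \<psi> \<beta>"
    and lin: "\<And>\<alpha> \<beta>. \<phi> (\<lambda>i. \<alpha> i + \<beta> i) = \<phi> \<alpha> + \<phi> \<beta>" "\<And>k \<alpha>. \<phi> (\<lambda>i. k * \<alpha> i) = int k * \<phi> \<alpha>"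
      "\<And>\<alpha> \<beta>. \<psi> (\<lambda>i. \<alpha> i + \<beta> i) = \<psi> \<alpha> + \<psi> \<beta>" "\<And>k \<alpha>. \<psi> (\<lambda>i. k * \<alpha> i) = int k * \<psi> \<alpha>"
    and one: "\<phi> gx - \<psi> gy = 1"
  shows "torsion_free \<langle>set B1 \<union> set B2\<rangle>"
proof -
  have half: "comb B1 \<alpha> + comb B2 \<alpha>' = comb B1 \<beta> + comb B2 \<beta>'"
    if k: "k > 0" and e1: "comb A1 (\<lambda>i. k * \<alpha> i) = comb A1 (\<lambda>i. k * \<beta> i + c * gx i)"
      and e2: "comb A2 (\<lambda>i. k * \<alpha>' i + c * gy i) = comb A2 (\<lambda>i. k * \<beta>' i)" for k c \<alpha> \<alpha>' \<beta> \<beta>'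
  proof -
    have "int k * \<phi> \<alpha> = int k * \<phi> \<beta> + int c * \<phi> gx" using inv(1)[OF e1] by (simp add: lin)
    moreover have "int k * \<psi> \<alpha>' + int c * \<psi> gy = int k * \<psi> \<beta>'" using inv(2)[OF e2] by (simp add: lin)
    moreover have "int c = int c * \<phi> gx - int c * \<psi> gy" using one by (simp flip: right_diff_distrib)
    ultimately have "int c = int k * (\<phi> \<alpha> - \<phi> \<beta> + \<psi> \<alpha>' - \<psi> \<beta>')" by (simp add: algebra_simps)
    then have "int k dvd int c" by simp
    \<comment> \<open>With \<open>c = k * c'\<close> both relations are equations between
      \<open>k\<close>-fold elements, so torsion-freeness of the two components removes the factor
      \<open>k\<close>.\<close>
    then obtain c' where c: "c = k * c'" by (auto simp: int_dvd_int_iff)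
    have "comb A1 \<alpha> = comb A1 (\<lambda>i. \<beta> i + c' * gx i)"
      by (rule torsion_freeD_comb[OF tf(1) k]) (use e1 c in \<open>simp add: algebra_simps\<close>)
    moreover have "comb A2 (\<lambda>i. \<alpha>' i + c' * gy i) = comb A2 \<beta>'"
      by (rule torsion_freeD_comb[OF tf(2) k]) (use e2 c in \<open>simp add: algebra_simps\<close>)
    ultimately show ?thesis unfolding glue by blast
  qed
  have "torsion_free \<langle>set (B1 @ B2)\<rangle>"
  proof (rule torsion_freeI_comb)
    fix k :: nat and \<alpha> \<beta> :: "nat \<Rightarrow> nat"
    let ?n = "length B1"
    assume k: "k > 0" and "comb (B1 @ B2) (\<lambda>i. k * \<alpha> i) = comb (B1 @ B2) (\<lambda>i. k * \<beta> i)"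
    then obtain c where
      "(comb A1 (\<lambda>i. k * \<alpha> i) = comb A1 (\<lambda>i. k * \<beta> i + c * gx i) \<and>
        comb A2 (\<lambda>i. k * \<alpha> (?n + i) + c * gy i) = comb A2 (\<lambda>i. k * \<beta> (?n + i))) \<or>
       (comb A1 (\<lambda>i. k * \<alpha> i + c * gx i) = comb A1 (\<lambda>i. k * \<beta> i) \<and>
        comb A2 (\<lambda>i. k * \<alpha> (?n + i)) = comb A2 (\<lambda>i. k * \<beta> (?n + i) + c * gy i))"
      unfolding comb_append glue by blast
    then show "comb (B1 @ B2) \<alpha> = comb (B1 @ B2) \<beta>"
    proof
      assume "comb A1 (\<lambda>i. k * \<alpha> i) = comb A1 (\<lambda>i. k * \<beta> i + c * gx i) \<and>
        comb A2 (\<lambda>i. k * \<alpha> (?n + i) + c * gy i) = comb A2 (\<lambda>i. k * \<beta> (?n + i))"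
      then show ?thesis unfolding comb_append by (intro half[OF k, of _ _ c]) simp_all
    next
      assume "comb A1 (\<lambda>i. k * \<alpha> i + c * gx i) = comb A1 (\<lambda>i. k * \<beta> i) \<and>
        comb A2 (\<lambda>i. k * \<alpha> (?n + i)) = comb A2 (\<lambda>i. k * \<beta> (?n + i) + c * gy i)"
      then show ?thesis unfolding comb_append by (intro half[OF k, of _ _ c, symmetric]) simp_all
    qed
  qed
  then show ?thesis by simp
qed

text \<open>The hypotheses say that modulo the two kernels \<open>gx\<close> is \<open>d\<close>
  times \<open>\<alpha> - \<beta>\<close> and \<open>gy\<close> is \<open>d\<close> times
  \<open>\<alpha>' - \<beta>'\<close>. So \<open>d\<close> times
  \<open>(\<alpha> - \<beta>, \<beta>' - \<alpha>')\<close> is a relation of the glued semigroup,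
  and torsion-freeness makes the vector itself a relation with some multiplier \<open>c\<close>.
  Multiplying back by \<open>d\<close> compares \<open>gx\<close> with a multiple of itself, which
  forces that multiple to be one.\<close>

lemma gluing_relation_primitive:
  assumes tf: "torsion_free \<langle>set B1 \<union> set B2\<rangle>"
    and x: "comb A1 (\<lambda>i. gx i + d * \<beta> i) = comb A1 (\<lambda>i. d * \<alpha> i)"
    and y: "comb A2 (\<lambda>i. gy i + d * \<beta>' i) = comb A2 (\<lambda>i. d * \<alpha>' i)"
  shows "d = 1"
proof -
  have no0: "comb A1 gx \<noteq> 0" using gx_absorb[of "\<lambda>i. 0" 1] by auto
  \<comment> \<open>For \<open>d = 0\<close> the hypothesis \<open>x\<close> would make
    \<open>gx\<close> vanish in the first semigroup.\<close>
  then have d: "d > 0" using x by (cases d) auto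
  have "comb B1 (\<lambda>i. d * \<alpha> i) + comb B2 (\<lambda>i. d * \<beta>' i) = comb B1 (\<lambda>i. d * \<beta> i) + comb B2 (\<lambda>i. d * \<alpha>' i)"
    unfolding glue by (intro exI[of _ 1]) (use x y in \<open>simp add: add.commute\<close>)
  from glued_torsion_freeD[OF tf d this] obtain c where
    "comb A1 \<alpha> = comb A1 (\<lambda>i. \<beta> i + c * gx i) \<or> comb A1 (\<lambda>i. \<alpha> i + c * gx i) = comb A1 \<beta>"
    unfolding glue by blast
  then show "d = 1"
  proof
    assume "comb A1 \<alpha> = comb A1 (\<lambda>i. \<beta> i + c * gx i)"
    then have "nmult d (comb A1 \<alpha>) = nmult d (comb A1 (\<lambda>i. \<beta> i + c * gx i))" by simp
    then have "comb A1 (\<lambda>i. d * \<beta> i) + comb A1 gx = comb A1 (\<lambda>i. d * \<beta> i) + comb A1 (\<lambda>i. (d * c) * gx i)"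
      unfolding comb_mult[symmetric] x[symmetric] comb_add[symmetric] by (simp add: algebra_simps)
    then have e: "comb A1 gx = comb A1 (\<lambda>i. (d * c) * gx i)" by (rule cancellative_comb[OF canc1])
    have dc: "d * c \<noteq> 0"
    proof
      assume "d * c = 0"
      then show False using e no0 by (simp only: mult_zero_left comb_zero)
    qed
    \<comment> \<open>One copy of \<open>gx\<close> is split off, so that the remaining
      \<open>d * c - 1\<close> copies are absorbed and must be none.\<close>
    then have "(\<lambda>i. (d * c) * gx i) = (\<lambda>i. gx i + (d * c - 1) * gx i)"
      by (cases "d * c") auto
    then have "d * c - 1 = 0" using e gx_absorb[of gx "d * c - 1"] by simp
    then have "d * c = 1" using dc by linarith
    then show "d = 1" by simp
  next
    assume "comb A1 (\<lambda>i. \<alpha> i + c * gx i) = comb A1 \<beta>"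
    then have "nmult d (comb A1 (\<lambda>i. \<alpha> i + c * gx i)) = nmult d (comb A1 \<beta>)" by simp
    then have "comb A1 (\<lambda>i. d * \<alpha> i) + comb A1 (\<lambda>i. (d * c) * gx i) = comb A1 (\<lambda>i. d * \<beta> i)"
      unfolding comb_mult[symmetric] comb_add[symmetric] by (simp add: algebra_simps)
    \<comment> \<open>A negative multiplier is impossible: it would make a positive number of copies
      of \<open>gx\<close> absorbable.\<close>
    then have "comb A1 (\<lambda>i. d * \<beta> i + (1 + d * c) * gx i) = comb A1 (\<lambda>i. d * \<beta> i)"
      unfolding x[symmetric] comb_add[symmetric] by (simp add: algebra_simps)
    then show "d = 1" using gx_absorb by fastforce
  qed
qed

section \<open>Minimal generation and coefficient sums\<close>

text \<open>An expression of \<open>B1 ! i\<close> by the other generators is a relation with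
  multiplier \<open>c\<close>. In one direction the \<open>A2\<close> part is a zero combination
  containing \<open>c\<close> copies of \<open>gy\<close>, so \<open>c = 0\<close> and
  \<open>A1 ! i\<close> itself is redundant. In the other direction \<open>c\<close> copies of
  \<open>gx\<close> fit into a single copy of generator \<open>i\<close>, so the entries of
  \<open>gx\<close> sum to at most one.\<close>

lemma irredundant_B1:
  assumes g: "(\<Sum>i<length A1. gx i) > 1" and i: "i < length A1" and \<alpha>: "\<alpha> i = 0"
  shows "comb B1 \<alpha> + comb B2 \<alpha>' \<noteq> B1 ! i"
proof
  let ?e = "\<lambda>j. if j = i then 1 else 0 :: nat"
  assume "comb B1 \<alpha> + comb B2 \<alpha>' = B1 ! i"
  then have "comb B1 \<alpha> + comb B2 \<alpha>' = comb B1 ?e + comb B2 (\<lambda>i. 0)"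
    using comb_unit[of i B1] i length1 by simp
  then obtain c where
    "(comb A1 \<alpha> = comb A1 (\<lambda>j. ?e j + c * gx j) \<and> comb A2 (\<lambda>i. \<alpha>' i + c * gy i) = comb A2 (\<lambda>i. 0)) \<or>
     comb A1 (\<lambda>i. \<alpha> i + c * gx i) = comb A1 ?e"
    unfolding glue by blast
  then show False
  proof
    assume a: "comb A1 \<alpha> = comb A1 (\<lambda>j. ?e j + c * gx j) \<and> comb A2 (\<lambda>i. \<alpha>' i + c * gy i) = comb A2 (\<lambda>i. 0)"
    obtain j where j: "j < length A2" "gy j \<noteq> 0" using gy_nz by blast
    have "\<alpha>' j + c * gy j = 0"
      using reduced_comb_eq_0[OF red2 irr2, of "\<lambda>i. \<alpha>' i + c * gy i" j] a j by simp
    then have "c = 0" using j by simp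
    then have "comb A1 \<alpha> = A1 ! i" using a comb_unit[OF i] by simp
    then show False using irredundantD[OF irr1 i, of \<alpha>] \<alpha> by simp
  next
    assume "comb A1 (\<lambda>i. \<alpha> i + c * gx i) = comb A1 ?e"
    then have a: "comb A1 (\<lambda>i. \<alpha> i + c * gx i) = A1 ! i" using comb_unit[OF i] by simp
    have n: "c * gx i \<noteq> 0"
      using irredundantD[OF irr1 i, of "\<lambda>i. \<alpha> i + c * gx i"] a \<alpha> by (intro notI) auto
    \<comment> \<open>One copy of generator \<open>i\<close> is taken out. The truncated subtraction
      is exact because \<open>c * gx i\<close> is positive; what remains must be zero.\<close>
    have "comb A1 (\<lambda>j. \<alpha> j + c * gx j) = comb A1 (\<lambda>j. ?e j + (\<alpha> j + (c * gx j - ?e j)))"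
      by (rule comb_cong) (use n in auto)
    then have "comb A1 ?e + comb A1 (\<lambda>j. \<alpha> j + (c * gx j - ?e j)) = comb A1 ?e + comb A1 (\<lambda>i. 0)"
      unfolding comb_add[of A1 ?e] using a comb_unit[OF i] by simp
    from cancellative_comb[OF canc1 this]
    have z: "comb A1 (\<lambda>j. \<alpha> j + (c * gx j - ?e j)) = 0" by simp
    have "gx j \<le> ?e j" if j: "j < length A1" for j
    proof -
      have "c * gx j \<le> ?e j" using reduced_comb_eq_0[OF red1 irr1 z j] by simp
      moreover have "gx j \<le> c * gx j" using n by (cases c) auto
      ultimately show ?thesis by (rule order_trans[rotated])
    qed
    then have "(\<Sum>j<length A1. gx j) \<le> (\<Sum>j<length A1. ?e j)" by (intro sum_mono) simp
    also have "\<dots> = 1" using i by simp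
    finally show False using g by simp
  qed
qed

lemma irredundant_append:
  assumes "(\<Sum>i<length A1. gx i) > 1" "(\<Sum>i<length A2. gy i) > 1"
  shows "irredundant (B1 @ B2)"
  unfolding irredundant_def
proof (intro allI impI)
  fix i and \<alpha> :: "nat \<Rightarrow> nat"
  assume i: "i < length (B1 @ B2)" and \<alpha>: "\<alpha> i = 0"
  show "comb (B1 @ B2) \<alpha> \<noteq> (B1 @ B2) ! i"
  proof (cases "i < length B1")
    case True
    then show ?thesis
      using irredundant_B1[OF assms(1), of i \<alpha>] \<alpha> length1 by (simp add: comb_append nth_append)
  next
    case False
    then show ?thesis
      using glue_relation.irredundant_B1[OF swap assms(2), of "i - length B1" "\<lambda>i. \<alpha> (length B1 + i)" \<alpha>]
        \<alpha> i length2 by (simp add: comb_append nth_append add.commute)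
  qed
qed

text \<open>A nonzero \<open>gx\<close> with smaller sum is a unit vector, and then the gluing
  relation expresses the generator \<open>B1 ! i\<close> by \<open>B2\<close> alone.\<close>

lemma sum_gx_gt_1:
  assumes "irredundant (B1 @ B2)"
  shows "(\<Sum>i<length A1. gx i) > 1"
proof (rule ccontr)
  assume n: "\<not> (\<Sum>i<length A1. gx i) > 1"
  obtain i where i: "i < length A1" "gx i \<noteq> 0" using gx_nz by blast
  let ?e = "\<lambda>j. if j = i then 1 else 0 :: nat"
  have "(\<Sum>j<length A1. gx j) = gx i + (\<Sum>j\<in>{..<length A1} - {i}. gx j)"
    using i by (simp add: sum.remove)
  then have gi: "gx i = 1" and s0: "(\<Sum>j\<in>{..<length A1} - {i}. gx j) = 0" using n i by linarith+
  then have "gx j = ?e j" if "j < length A1" for j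
    using that by (cases "j = i") auto
  then have "comb A1 ?e = comb A1 gx" by (intro comb_cong) simp
  then have "comb B1 ?e + comb B2 (\<lambda>i. 0) = comb B1 (\<lambda>i. 0) + comb B2 gy"
    unfolding glue by (intro exI[of _ 1]) simp
  then have e: "comb B2 gy = B1 ! i" using comb_unit[of i B1] i length1 by simp
  have "comb (B1 @ B2) (\<lambda>j. if j < length B1 then 0 else gy (j - length B1)) = (B1 @ B2) ! i"
    using comb_split_append[of B1 B2 "\<lambda>i. 0" gy] e i length1 by (simp add: nth_append)
  then show False using irredundantD[OF assms, of i "\<lambda>j. if j < length B1 then 0 else gy (j - length B1)"]
    i length1 by simp
qed

lemma irredundant_append_swap: "irredundant (B1 @ B2) \<Longrightarrow> irredundant (B2 @ B1)"
  unfolding irredundant_iff by (auto simp: Un_commute)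

lemma sum_gy_gt_1: "irredundant (B1 @ B2) \<Longrightarrow> (\<Sum>i<length A2. gy i) > 1"
  by (rule glue_relation.sum_gx_gt_1[OF swap irredundant_append_swap])

text \<open>Minimal generation by a disjoint union is irredundance of \<open>B1 @ B2\<close>, which
  the coefficient sums characterise. The ideal identity is supplied by \<open>gluing_ideal\<close>;
  its hypothesis \<open>rel\<close> is \<open>glue\<close> carried over to \<open>B1\<close> and
  \<open>B2\<close> by the two embeddings.\<close>

lemma is_gluing_iff:
  assumes "fg_red_canc \<langle>set B1 \<union> set B2\<rangle>" "distinct B1" "distinct B2"
  shows "is_gluing TYPE('k::field) \<langle>set B1 \<union> set B2\<rangle> (set B1) (set B2) \<longleftrightarrow>
    (\<Sum>i<length A1. gx i) > 1 \<and> (\<Sum>i<length A2. gy i) > 1"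
proof
  assume "is_gluing TYPE('k) \<langle>set B1 \<union> set B2\<rangle> (set B1) (set B2)"
  then have "irredundant (B1 @ B2)"
    unfolding irredundant_iff is_gluing_def using assms by simp
  then show "(\<Sum>i<length A1. gx i) > 1 \<and> (\<Sum>i<length A2. gy i) > 1"
    using sum_gx_gt_1 sum_gy_gt_1 by blast
next
  assume "(\<Sum>i<length A1. gx i) > 1 \<and> (\<Sum>i<length A2. gy i) > 1"
  then have irr: "irredundant (B1 @ B2)" using irredundant_append by blast
  then have dist: "distinct (B1 @ B2)" and min: "minimally_generates (set B1 \<union> set B2) \<langle>set B1 \<union> set B2\<rangle>"
    unfolding irredundant_iff by simp_all
  have rel: "\<exists>c. (comb B1 \<alpha> = comb B1 (\<lambda>i. \<beta> i + c * gx i) \<and> comb B2 (\<lambda>i. \<alpha>' i + c * gy i) = comb B2 \<beta>') \<or>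
          (comb B1 (\<lambda>i. \<alpha> i + c * gx i) = comb B1 \<beta> \<and> comb B2 \<alpha>' = comb B2 (\<lambda>i. \<beta>' i + c * gy i))"
    if "comb B1 \<alpha> + comb B2 \<alpha>' = comb B1 \<beta> + comb B2 \<beta>'" for \<alpha> \<alpha>' \<beta> \<beta>'
    using that unfolding comb_B1_eq_iff comb_B2_eq_iff glue .
  note id = gluing_ideal[OF dist comb_gx_eq_comb_gy rel, where ?'k = 'k]
  show "is_gluing TYPE('k) \<langle>set B1 \<union> set B2\<rangle> (set B1) (set B2)"
    unfolding is_gluing_def Let_def
    using assms(1) dist min id keys_expo[of B1 gx] keys_expo[of B2 gy]
    by (intro conjI exI[of _ "expo B1 gx"] exI[of _ "expo B2 gy"]) auto
qed

end

section \<open>The criterion\<close>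

lemma int_vec_add: "int_vec n (\<lambda>i. \<alpha> i + \<beta> i) = int_vec n \<alpha> + int_vec n \<beta>"
  by (rule eq_vecI) simp_all

lemma int_vec_mult: "int_vec n (\<lambda>i. k * \<alpha> i) = int k \<cdot>\<^sub>v int_vec n \<alpha>"
  by (rule eq_vecI) simp_all

text \<open>A linear form in Smith coordinates that involves only the last \<open>s\<close> of them,
  those of the zero columns, and hence vanishes on the row lattice. With indices starting at zero
  they run from \<open>n - s\<close> to \<open>n - 1\<close>.\<close>

definition tail_functional :: "nat \<Rightarrow> nat \<Rightarrow> int mat \<Rightarrow> (nat \<Rightarrow> int) \<Rightarrow> (nat \<Rightarrow> nat) \<Rightarrow> int" where
  "tail_functional n s Q f \<alpha> = (\<Sum>j=n - s..<n. f j * vec_mat (int_vec n \<alpha>) Q $ j)"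

lemma tail_functional_add:
  assumes "Q \<in> carrier_mat n n"
  shows "tail_functional n s Q f (\<lambda>i. \<alpha> i + \<beta> i) = tail_functional n s Q f \<alpha> + tail_functional n s Q f \<beta>"
  using assms unfolding tail_functional_def sum.distrib[symmetric]
  by (intro sum.cong) (simp_all add: int_vec_add vec_mat_add[OF assms] distrib_left)

lemma tail_functional_mult:
  assumes "Q \<in> carrier_mat n n"
  shows "tail_functional n s Q f (\<lambda>i. k * \<alpha> i) = int k * tail_functional n s Q f \<alpha>"
  using assms unfolding tail_functional_def sum_distrib_left
  by (intro sum.cong) (simp_all add: int_vec_mult vec_mat_smult[OF assms] mult.left_commute)

text \<open>Exponents of the same element differ by a vector of the row lattice, whose tail
  coordinates are zero by \<open>smith_tail_zero\<close>. So the form descends to the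
  semigroup.\<close>

lemma tail_functional_invariant:
  assumes L: "dim_col L = n" "row_lattice L = ker_sgp A" and n: "n = length A"
    and c: "cancellative \<langle>set A\<rangle>"
    and P: "unimodular (dim_row L) P" and Q: "unimodular n Q"
    and z: "zero_cols_right (P * L * Q)" and s: "s = num_zero_cols (P * L * Q)"
    and e: "comb A \<alpha> = comb A \<beta>"
  shows "tail_functional n s Q f \<alpha> = tail_functional n s Q f \<beta>"
  unfolding tail_functional_def
proof (rule sum.cong)
  fix j assume j: "j \<in> {n - s..<n}"
  have Q': "Q \<in> carrier_mat n n" using Q by (simp add: unimodular_def)
  have "int_vec n \<alpha> - int_vec n \<beta> \<in> row_lattice L"
    unfolding L(2) int_vec_diff_in_ker_iff[OF c n] by (rule e)
  then have "vec_mat (int_vec n \<alpha> - int_vec n \<beta>) Q $ j = 0"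
    using smith_tail_zero[OF P Q[folded L(1)] refl z, of _ j] j by (simp add: L(1) s)
  then show "f j * vec_mat (int_vec n \<alpha>) Q $ j = f j * vec_mat (int_vec n \<beta>) Q $ j"
    using vec_mat_minus[OF Q', of "int_vec n \<alpha>" "int_vec n \<beta>"] Q' j by simp
qed simp

text \<open>Dividing the Smith coordinates of \<open>g\<close> by \<open>d\<close> gives a vector
  \<open>x\<close> such that \<open>g - d x\<close> has zero tail. A positive multiple of this
  difference lies in the kernel, and the kernel is saturated by torsion-freeness.\<close>

lemma smith_divisible:
  assumes L: "dim_col L = n" "row_lattice L = ker_sgp A" and n: "n = length A"
    and c: "cancellative \<langle>set A\<rangle>" and tf: "torsion_free \<langle>set A\<rangle>"
    and P: "unimodular (dim_row L) P" and Q: "unimodular n Q"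
    and snf: "smith_normal_form (P * L * Q)"
    and z: "zero_cols_right (P * L * Q)" and s: "s = num_zero_cols (P * L * Q)"
    and dvd: "\<And>j. n - s \<le> j \<Longrightarrow> j < n \<Longrightarrow> int d dvd vec_mat (int_vec n g) Q $ j"
  shows "\<exists>\<alpha> \<beta>. comb A (\<lambda>i. g i + d * \<beta> i) = comb A (\<lambda>i. d * \<alpha> i)"
proof -
  have Q': "Q \<in> carrier_mat n n" using Q by (simp add: unimodular_def)
  \<comment> \<open>The division is exact on the tail only; the other coordinates may be rounded,
    since they do not affect the zero tail. For \<open>d = 0\<close> the tail of \<open>g\<close> is
    zero by \<open>dvd\<close> and the quotient is zero by convention.\<close>
  define w where "w = vec n (\<lambda>j. vec_mat (int_vec n g) Q $ j div int d)"
  obtain x where x: "x \<in> carrier_vec n" "vec_mat x Q = w"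
    using unimodular_surj[OF Q, of w] by (auto simp: w_def)
  let ?y = "int_vec n g - int d \<cdot>\<^sub>v x"
  have y: "?y \<in> carrier_vec n" using x by simp
  have "vec_mat ?y Q = vec_mat (int_vec n g) Q - int d \<cdot>\<^sub>v w"
    using x by (simp add: vec_mat_minus[OF Q'] vec_mat_smult[OF Q'])
  then have "vec_mat ?y Q $ j = 0" if "n - s \<le> j" "j < n" for j
    using that dvd[OF that] by (simp add: w_def)
  then obtain N :: nat where N: "N > 0" "int N \<cdot>\<^sub>v ?y \<in> ker_sgp A"
    using smith_multiple_in_row_lattice[OF P Q[folded L(1)] refl snf z, of ?y] y
    unfolding L s by blast
  then have k: "?y \<in> ker_sgp A"
    using torsion_free_ker[OF tf c, of ?y N] y n by simp
  obtain \<alpha> \<beta> where ab: "x = int_vec n \<alpha> - int_vec n \<beta>" using int_vec_diff_cases[OF x(1)] .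
  have "?y = int_vec n (\<lambda>i. g i + d * \<beta> i) - int_vec n (\<lambda>i. d * \<alpha> i)"
    unfolding ab by (rule eq_vecI) (simp_all add: algebra_simps)
  then show ?thesis using k int_vec_diff_in_ker_iff[OF c n] by metis
qed

text \<open>Equality in the glued semigroup is membership of a concatenated difference vector in the
  row lattice, which \<open>append_in_row_lattice_glue_mat_iff\<close> resolves into the two
  kernels.\<close>

lemma glue_relation_of_ker:
  assumes n: "r = length A1" "t = length A2" "length B1 = r" "length B2 = t"
    and c1: "cancellative \<langle>set A1\<rangle>" and c2: "cancellative \<langle>set A2\<rangle>"
    and cB: "cancellative \<langle>set B1 \<union> set B2\<rangle>"
    and L1: "dim_col L1 = r" "row_lattice L1 = ker_sgp A1"
    and L2: "dim_col L2 = t" "row_lattice L2 = ker_sgp A2"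
    and ker: "ker_sgp (B1 @ B2) = row_lattice (glue_mat L1 L2 (int_vec r gx) (int_vec t gy))"
  shows "comb B1 \<alpha> + comb B2 \<alpha>' = comb B1 \<beta> + comb B2 \<beta>' \<longleftrightarrow>
      (\<exists>c. (comb A1 \<alpha> = comb A1 (\<lambda>i. \<beta> i + c * gx i) \<and> comb A2 (\<lambda>i. \<alpha>' i + c * gy i) = comb A2 \<beta>') \<or>
          (comb A1 (\<lambda>i. \<alpha> i + c * gx i) = comb A1 \<beta> \<and> comb A2 \<alpha>' = comb A2 (\<lambda>i. \<beta>' i + c * gy i)))"
proof -
  let ?x = "int_vec r \<alpha> - int_vec r \<beta>" and ?y = "int_vec t \<alpha>' - int_vec t \<beta>'"
  let ?gX = "int_vec r gx" and ?gY = "int_vec t gy"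
  let ?R = "\<lambda>c. ?x - c \<cdot>\<^sub>v ?gX \<in> ker_sgp A1 \<and> ?y + c \<cdot>\<^sub>v ?gY \<in> ker_sgp A2"
  let ?a = "\<lambda>i. if i < length B1 then \<alpha> i else \<alpha>' (i - length B1)"
  let ?b = "\<lambda>i. if i < length B1 then \<beta> i else \<beta>' (i - length B1)"
  have "comb B1 \<alpha> + comb B2 \<alpha>' = comb B1 \<beta> + comb B2 \<beta>' \<longleftrightarrow> comb (B1 @ B2) ?a = comb (B1 @ B2) ?b"
    by (simp only: comb_split_append)
  also have "\<dots> \<longleftrightarrow> int_vec (r + t) ?a - int_vec (r + t) ?b \<in> ker_sgp (B1 @ B2)"
    by (rule int_vec_diff_in_ker_iff[symmetric]) (use cB n in simp_all)
  also have "int_vec (r + t) ?a - int_vec (r + t) ?b = ?x @\<^sub>v ?y"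
    using n by (intro eq_vecI) auto
  also have "?x @\<^sub>v ?y \<in> ker_sgp (B1 @ B2) \<longleftrightarrow> (\<exists>c. ?R c)"
    unfolding ker by (subst append_in_row_lattice_glue_mat_iff) (simp_all add: L1 L2)
  \<comment> \<open>The sign of the integer multiplier decides which side receives the copies of
    \<open>gx\<close> and of \<open>gy\<close>.\<close>
  also have "\<dots> \<longleftrightarrow> (\<exists>k. ?R (int k) \<or> ?R (- int k))"
    by (metis int_cases2)
  also have "\<dots> \<longleftrightarrow> (\<exists>c. (comb A1 \<alpha> = comb A1 (\<lambda>i. \<beta> i + c * gx i) \<and> comb A2 (\<lambda>i. \<alpha>' i + c * gy i) = comb A2 \<beta>') \<or>
          (comb A1 (\<lambda>i. \<alpha> i + c * gx i) = comb A1 \<beta> \<and> comb A2 \<alpha>' = comb A2 (\<lambda>i. \<beta>' i + c * gy i)))"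
  proof (rule ex_cong1)
    fix k :: nat
    have e: "?x - int k \<cdot>\<^sub>v ?gX = int_vec r \<alpha> - int_vec r (\<lambda>i. \<beta> i + k * gx i)"
      "?y + int k \<cdot>\<^sub>v ?gY = int_vec t (\<lambda>i. \<alpha>' i + k * gy i) - int_vec t \<beta>'"
      "?x - (- int k) \<cdot>\<^sub>v ?gX = int_vec r (\<lambda>i. \<alpha> i + k * gx i) - int_vec r \<beta>"
      "?y + (- int k) \<cdot>\<^sub>v ?gY = int_vec t \<alpha>' - int_vec t (\<lambda>i. \<beta>' i + k * gy i)"
      by (rule eq_vecI; simp)+
    show "(?R (int k) \<or> ?R (- int k)) \<longleftrightarrow>
        (comb A1 \<alpha> = comb A1 (\<lambda>i. \<beta> i + k * gx i) \<and> comb A2 (\<lambda>i. \<alpha>' i + k * gy i) = comb A2 \<beta>') \<or>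
          (comb A1 (\<lambda>i. \<alpha> i + k * gx i) = comb A1 \<beta> \<and> comb A2 \<alpha>' = comb A2 (\<lambda>i. \<beta>' i + k * gy i))"
      unfolding e int_vec_diff_in_ker_iff[OF c1 n(1)] int_vec_diff_in_ker_iff[OF c2 n(2)] ..
  qed
  finally show ?thesis .
qed

lemma int_vec_nat:
  assumes "v \<in> carrier_vec n" "\<forall>i<n. 0 \<le> v $ i"
  shows "int_vec n (\<lambda>i. nat (v $ i)) = v"
  using assms by (intro eq_vecI) auto

text \<open>The gcd of the combinations obtained for the two families is again a combination. It is
  returned as a natural number so that it can serve as a multiplicity in
  \<open>comb\<close>.\<close>

lemma bezout_two_sums:
  fixes a b :: "nat \<Rightarrow> int"
  assumes "finite I" "finite J"
  obtains f g d where "(\<Sum>i\<in>I. f i * a i) + (\<Sum>j\<in>J. g j * b j) = int d"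
    and "\<And>i. i \<in> I \<Longrightarrow> int d dvd a i" and "\<And>j. j \<in> J \<Longrightarrow> int d dvd b j"
proof -
  obtain f g where f: "\<forall>j\<in>I. (\<Sum>i\<in>I. f i * a i) dvd a j" and g: "\<forall>j\<in>J. (\<Sum>i\<in>J. g i * b i) dvd b j"
    using bezout_finite_int[OF assms(1), of a] bezout_finite_int[OF assms(2), of b] by blast
  let ?p = "\<Sum>i\<in>I. f i * a i" and ?q = "\<Sum>j\<in>J. g j * b j"
  obtain u v where uv: "u * ?p + v * ?q = gcd ?p ?q" using bezout_int[of ?p ?q] by blast
  show thesis
  proof (rule that)
    show "(\<Sum>i\<in>I. (u * f i) * a i) + (\<Sum>j\<in>J. (v * g j) * b j) = int (nat (gcd ?p ?q))"
      using uv by (simp add: sum_distrib_left mult.assoc)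
    show "int (nat (gcd ?p ?q)) dvd a i" if "i \<in> I" for i
      using f that by (auto intro: dvd_trans[OF gcd_dvd1])
    show "int (nat (gcd ?p ?q)) dvd b j" if "j \<in> J" for j
      using g that by (auto intro: dvd_trans[OF gcd_dvd2])
  qed
qed

theorem corollary13:
  fixes A1 :: "'a::comm_monoid_add list" and A2 :: "'b::comm_monoid_add list"
    and B1 B2 :: "'c::comm_monoid_add list"
    and L1 L2 P1 P2 Q1 Q2 D1 D2 :: "int mat"
    and gX gY gX' gY' :: "int vec"
    and r t s1 s2 :: nat
  assumes "length A1 = r" "distinct A1" "minimally_generates (set A1) \<langle>set A1\<rangle>"
    and "fg_red_canc \<langle>set A1\<rangle>"
    and "length A2 = t" "distinct A2" "minimally_generates (set A2) \<langle>set A2\<rangle>"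
    and "fg_red_canc \<langle>set A2\<rangle>"
    and "(sgp_ideal (set A1) :: ('a, 'k::field) mpoly set) \<noteq> {0}"
    and "(sgp_ideal (set A1) :: ('a, 'k) mpoly set) \<noteq> carrier (poly_ring (set A1))"
    and "(sgp_ideal (set A2) :: ('b, 'k) mpoly set) \<noteq> {0}"
    and "(sgp_ideal (set A2) :: ('b, 'k) mpoly set) \<noteq> carrier (poly_ring (set A2))"
    and "dim_col L1 = r" "rows_form_basis L1 (ker_sgp A1)"
    and "dim_col L2 = t" "rows_form_basis L2 (ker_sgp A2)"
    and "gX \<in> carrier_vec r" "\<forall>i<r. 0 \<le> gX $ i" "gX \<noteq> 0\<^sub>v r"
    and "gY \<in> carrier_vec t" "\<forall>i<t. 0 \<le> gY $ i" "gY \<noteq> 0\<^sub>v t"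
    and "length B1 = r" "distinct B1" "length B2 = t" "distinct B2"
    and "fg_red_canc \<langle>set B1 \<union> set B2\<rangle>"
    and "ker_sgp (B1 @ B2) = row_lattice (glue_mat L1 L2 gX gY)"
    and "unimodular (dim_row L1) P1" "unimodular r Q1" "D1 = P1 * L1 * Q1"
    and "smith_normal_form D1" "zero_cols_right D1" "s1 = num_zero_cols D1"
    and "unimodular (dim_row L2) P2" "unimodular t Q2" "D2 = P2 * L2 * Q2"
    and "smith_normal_form D2" "zero_cols_right D2" "s2 = num_zero_cols D2"
    and "gX' = vec_mat gX Q1" "gY' = - vec_mat gY Q2"
  shows "(affine_sgp \<langle>set B1 \<union> set B2\<rangle> \<and>
          is_gluing TYPE('k) \<langle>set B1 \<union> set B2\<rangle> (set B1) (set B2))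
     \<longleftrightarrow> (affine_sgp \<langle>set A1\<rangle> \<and> affine_sgp \<langle>set A2\<rangle>)
       \<and> (\<forall>i<r + t. 0 \<le> (gX @\<^sub>v gY) $ i)
       \<and> ((\<Sum>i<r. gX $ i) > 1 \<and> (\<Sum>i<t. gY $ i) > 1)
       \<and> (\<exists>f g :: nat \<Rightarrow> int. (\<Sum>i=r - s1..<r. f i * gX' $ i) + (\<Sum>i=t - s2..<t. g i * gY' $ i) = 1)"
proof -
  note len = assms(1,5) and B = assms(23-27) and ker = assms(28)
  have canc: "cancellative \<langle>set A1\<rangle>" "cancellative \<langle>set A2\<rangle>" "cancellative \<langle>set B1 \<union> set B2\<rangle>"
    and red: "reduced \<langle>set A1\<rangle>" "reduced \<langle>set A2\<rangle>"
    using assms(4,8) B(5) by (simp_all add: fg_red_canc_def)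
  have irr: "irredundant A1" "irredundant A2"
    using assms(2,3,6,7) by (simp_all add: irredundant_iff)
  have L: "row_lattice L1 = ker_sgp A1" "row_lattice L2 = ker_sgp A2"
    using assms(14,16) by (simp_all add: rows_form_basis_def)
  define gx gy where "gx = (\<lambda>i. nat (gX $ i))" "gy = (\<lambda>i. nat (gY $ i))"
  have gX: "int_vec r gx = gX" and gY: "int_vec t gy = gY"
    using assms(17,18,20,21) by (simp_all add: gx_gy_def int_vec_nat)
  have gx_nz: "\<exists>i<r. gx i \<noteq> 0"
  proof (rule ccontr)
    assume "\<not> (\<exists>i<r. gx i \<noteq> 0)"
    then have "gX = 0\<^sub>v r" unfolding gX[symmetric] by (intro eq_vecI) auto
    then show False using assms(19) by simp
  qed
  have gy_nz: "\<exists>i<t. gy i \<noteq> 0"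
  proof (rule ccontr)
    assume "\<not> (\<exists>i<t. gy i \<noteq> 0)"
    then have "gY = 0\<^sub>v t" unfolding gY[symmetric] by (intro eq_vecI) auto
    then show False using assms(22) by simp
  qed
  interpret glue_relation A1 A2 B1 B2 gx gy
  proof
    show "comb B1 \<alpha> + comb B2 \<alpha>' = comb B1 \<beta> + comb B2 \<beta>' \<longleftrightarrow>
      (\<exists>c. (comb A1 \<alpha> = comb A1 (\<lambda>i. \<beta> i + c * gx i) \<and> comb A2 (\<lambda>i. \<alpha>' i + c * gy i) = comb A2 \<beta>') \<or>
          (comb A1 (\<lambda>i. \<alpha> i + c * gx i) = comb A1 \<beta> \<and> comb A2 \<alpha>' = comb A2 (\<lambda>i. \<beta>' i + c * gy i)))"
      for \<alpha> \<alpha>' \<beta> \<beta>'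
      by (rule glue_relation_of_ker[OF len[symmetric] B(1,3) canc assms(13) L(1) assms(15) L(2)])
        (simp add: ker gX gY)
  qed (use len B canc red irr gx_nz gy_nz in simp_all)
  have P: "unimodular (dim_row L1) P1" "unimodular (dim_row L2) P2"
    and Q: "unimodular r Q1" "unimodular t Q2" using assms(29,35,30,36) .
  have Q': "Q1 \<in> carrier_mat r r" "Q2 \<in> carrier_mat t t" using Q by (simp_all add: unimodular_def)
  have D1: "smith_normal_form (P1 * L1 * Q1)" "zero_cols_right (P1 * L1 * Q1)" "s1 = num_zero_cols (P1 * L1 * Q1)"
    using assms(31-34) by simp_all
  have D2: "smith_normal_form (P2 * L2 * Q2)" "zero_cols_right (P2 * L2 * Q2)" "s2 = num_zero_cols (P2 * L2 * Q2)"
    using assms(37-40) by simp_all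
  have gX': "gX' $ i = vec_mat gX Q1 $ i" for i using assms(41) by simp
  have gY': "gY' $ i = - vec_mat gY Q2 $ i" if "i < t" for i using assms(42) Q'(2) that by simp
  have cond4: "torsion_free \<langle>set B1 \<union> set B2\<rangle> \<longleftrightarrow> torsion_free \<langle>set A1\<rangle> \<and> torsion_free \<langle>set A2\<rangle> \<and>
      (\<exists>f g :: nat \<Rightarrow> int. (\<Sum>i=r - s1..<r. f i * gX' $ i) + (\<Sum>i=t - s2..<t. g i * gY' $ i) = 1)"
    (is "?S \<longleftrightarrow> ?T1 \<and> ?T2 \<and> ?C")
  proof
    assume S: ?S
    then have T: ?T1 ?T2 by (rule torsion_free_A1, rule torsion_free_A2)
    \<comment> \<open>Here \<open>d\<close> is the gcd of all tail coordinates, possibly zero a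
      priori. It divides the gluing vector modulo the two kernels, so primitivity forces
      \<open>d = 1\<close>.\<close>
    obtain f g d where fg: "(\<Sum>i=r - s1..<r. f i * gX' $ i) + (\<Sum>i=t - s2..<t. g i * gY' $ i) = int d"
      and dX: "\<And>i. i \<in> {r - s1..<r} \<Longrightarrow> int d dvd gX' $ i"
      and dY: "\<And>i. i \<in> {t - s2..<t} \<Longrightarrow> int d dvd gY' $ i"
      using bezout_two_sums[of "{r - s1..<r}" "{t - s2..<t}" "\<lambda>i. gX' $ i" "\<lambda>i. gY' $ i"] by auto
    obtain \<alpha> \<beta> where x: "comb A1 (\<lambda>i. gx i + d * \<beta> i) = comb A1 (\<lambda>i. d * \<alpha> i)"
      using smith_divisible[OF assms(13) L(1) len(1)[symmetric] canc(1) T(1) P(1) Q(1) D1, of d gx] dX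
      by (auto simp: gX gX')
    obtain \<alpha>' \<beta>' where y: "comb A2 (\<lambda>i. gy i + d * \<beta>' i) = comb A2 (\<lambda>i. d * \<alpha>' i)"
      using smith_divisible[OF assms(15) L(2) len(2)[symmetric] canc(2) T(2) P(2) Q(2) D2, of d gy] dY
      by (auto simp: gY gY')
    have "d = 1" by (rule gluing_relation_primitive[OF S x y])
    then show "?T1 \<and> ?T2 \<and> ?C" using T fg by auto
  next
    assume a: "?T1 \<and> ?T2 \<and> ?C"
    then obtain f g where
      fg: "(\<Sum>i=r - s1..<r. f i * gX' $ i) + (\<Sum>i=t - s2..<t. g i * gY' $ i) = 1" by blast
    \<comment> \<open>\<open>gY'\<close> carries a minus sign, which turns the Bezout sum into the
      difference of functionals that \<open>glued_torsion_freeI\<close> asks for.\<close>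
    have m: "(\<Sum>i=t - s2..<t. g i * gY' $ i) = - (\<Sum>i=t - s2..<t. g i * vec_mat gY Q2 $ i)"
      unfolding sum_negf[symmetric] by (rule sum.cong) (simp_all add: gY')
    show ?S
    proof (rule glued_torsion_freeI)
      show "tail_functional r s1 Q1 f gx - tail_functional t s2 Q2 g gy = 1"
        using fg m by (simp add: tail_functional_def gX gY gX')
      show "tail_functional r s1 Q1 f \<alpha> = tail_functional r s1 Q1 f \<beta>"
        if "comb A1 \<alpha> = comb A1 \<beta>" for \<alpha> \<beta>
        by (rule tail_functional_invariant[OF assms(13) L(1) len(1)[symmetric] canc(1) P(1) Q(1) D1(2,3) that])
      show "tail_functional t s2 Q2 g \<alpha> = tail_functional t s2 Q2 g \<beta>"
        if "comb A2 \<alpha> = comb A2 \<beta>" for \<alpha> \<beta>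
        by (rule tail_functional_invariant[OF assms(15) L(2) len(2)[symmetric] canc(2) P(2) Q(2) D2(2,3) that])
    qed (use a in \<open>auto intro: tail_functional_add[OF Q'(1)] tail_functional_add[OF Q'(2)]
        tail_functional_mult[OF Q'(1)] tail_functional_mult[OF Q'(2)]\<close>)
  qed
  have aff: "affine_sgp \<langle>set A1\<rangle> \<longleftrightarrow> torsion_free \<langle>set A1\<rangle>" "affine_sgp \<langle>set A2\<rangle> \<longleftrightarrow> torsion_free \<langle>set A2\<rangle>"
    "affine_sgp \<langle>set B1 \<union> set B2\<rangle> \<longleftrightarrow> torsion_free \<langle>set B1 \<union> set B2\<rangle>"
    using assms(4,8) B(5) by (simp_all add: affine_sgp_def)
  have "(\<Sum>i<r. gX $ i) = int (\<Sum>i<r. gx i)" "(\<Sum>i<t. gY $ i) = int (\<Sum>i<t. gy i)"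
    using assms(18,21) by (simp_all add: gx_gy_def)
  then have sums: "((\<Sum>i<r. gX $ i) > 1 \<and> (\<Sum>i<t. gY $ i) > 1) \<longleftrightarrow>
      is_gluing TYPE('k) \<langle>set B1 \<union> set B2\<rangle> (set B1) (set B2)"
    unfolding is_gluing_iff[OF B(5) B(2) B(4), where ?'k = 'k] len by linarith
  have nonneg: "\<forall>i<r + t. 0 \<le> (gX @\<^sub>v gY) $ i"
    using assms(17,18,20,21) by auto
  show ?thesis unfolding sums aff using cond4 nonneg by blast
qed

end
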